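(* Let $D$ be a positive integer, let $k<0$ be an even integer, and put $\kappa:=|k|$. Let $\mathcal{M}_{k,D}$ be the complex vector space of weight $k$ modular local polynomials with exceptional set $E_D$, and for a fundamental domain $\mathbb{F}$ for $\operatorname{SL}_2(\mathbb{Z})$ let $r_{\mathbb{F}}$ be the number of connected components of $\mathbb{H}\setminus E_D$ that have non-empty intersection with $\mathbb{F}$. Then for every fundamental domain $\mathbb{F}$ for $\operatorname{SL}_2(\mathbb{Z})$, $$\dim_{\mathbb{C}}\left(\mathcal{M}_{k,D}\right)\leq (\kappa+1)\, r_{\mathbb{F}}.$$ Moreover, $$\dim_{\mathbb{C}}\left(\mathcal{M}_{k,D}\right)=(\kappa+1)\min_{\mathbb{F}} r_{\mathbb{F}}$$ (the minimum running over all fundamental domains $\mathbb{F}$ for $\operatorname{SL}_2(\mathbb{Z})$) if and only if $D$ is an even square, i.e. $D=4m^2$ for some integer $m$.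
   Context: $\mathbb{H}$ is the complex upper half-plane, on which $\operatorname{SL}_2(\mathbb{Z})$ acts by Möbius transformations. A fundamental domain for $\operatorname{SL}_2(\mathbb{Z})$ means any set $\mathbb{F}\subset\mathbb{H}$ containing precisely one element of each $\operatorname{SL}_2(\mathbb{Z})$-orbit in $\mathbb{H}$ (no further conditions). Exceptional set: for a positive integer $D$, let $\mathcal{Q}_D$ be the set of integral binary quadratic forms $Q=[a,b,c]$ ($Q(X,Y)=aX^2+bXY+cY^2$, $a,b,c\in\mathbb{Z}$) of discriminant $b^2-4ac=D$. Put $S_Q:=\{\tau\in\mathbb{H} : a|\tau|^2+b\operatorname{Re}(\tau)+c=0\}$ and $E_D:=\bigcup_{Q\in\mathcal{Q}_D}S_Q$. The set $E_D$ is $\operatorname{SL}_2(\mathbb{Z})$-invariant and nowhere dense in $\mathbb{H}$. Local polynomials: let $E\subset\mathbb{H}$ be an $\operatorname{SL}_2(\mathbb{Z})$-invariant nowhere dense set. A function $\mathcal{P}:\mathbb{H}\to\mathbb{C}$ is a local polynomial with exceptional set $E$ if for every connected component $\mathcal{C}\subset\mathbb{H}\setminus E$ there is a polynomial $P_{\mathcal{C}}$ (with complex coefficients) such that $\mathcal{P}(\tau)=P_{\mathcal{C}}(\tau)$ for all $\tau\in\mathcal{C}$. Average: for $\tau\in\mathbb{H}$ let $\mathscr{C}_\tau$ be the set of connected components $\mathcal{C}$ of $\mathbb{H}\setminus E$ with $\tau\in\mathcal{C}\cup\partial\mathcal{C}$, and, in the case of existence, put $$\mathcal{A}(\mathcal{P})(\tau):=\frac{1}{\#\mathscr{C}_\tau}\sum_{\mathcal{C}\in\mathscr{C}_\tau}\lim_{w\in\mathcal{C},\,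 w\to\tau}\mathcal{P}(w).$$ A function $\mathcal{P}:\mathbb{H}\to\mathbb{C}$ is a weight $k$ modular local polynomial with exceptional set $E$ ($k$ an even integer) if: (1) $\mathcal{P}|_k\gamma=\mathcal{P}$ for all $\gamma=\begin{pmatrix}a&b\\c&d\end{pmatrix}\in\operatorname{SL}_2(\mathbb{Z})$, where $(\mathcal{P}|_k\gamma)(\tau):=(c\tau+d)^{-k}\mathcal{P}\left(\frac{a\tau+b}{c\tau+d}\right)$; (2) $\mathcal{P}$ is a local polynomial with exceptional set $E$; (3) the limits defining $\mathcal{A}(\mathcal{P})(\tau)$ exist for all $\tau\in\mathbb{H}$ and $\mathcal{P}=\mathcal{A}(\mathcal{P})$ on $\mathbb{H}$. *)

theory Defs
  imports
    "HOL-Analysis.Analysis"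
    "HOL-Computational_Algebra.Polynomial"
    "HOL-Library.Function_Algebras"
    "HOL-Library.Extended_Nat"
begin

definition upper_half_plane :: "complex set" where
  "upper_half_plane = {\<tau>. Im \<tau> > 0}"

definition SL2Z :: "(int ^ 2 ^ 2) set" where
  "SL2Z = {\<gamma>. det \<gamma> = 1}"

definition automorphy :: "int ^ 2 ^ 2 \<Rightarrow> complex \<Rightarrow> complex" where
  "automorphy \<gamma> \<tau> = of_int (\<gamma> $ 2 $ 1) * \<tau> + of_int (\<gamma> $ 2 $ 2)"

definition SL2Z_act :: "int ^ 2 ^ 2 \<Rightarrow> complex \<Rightarrow> complex" where
  "SL2Z_act \<gamma> \<tau> = (of_int (\<gamma> $ 1 $ 1) * \<tau> + of_int (\<gamma> $ 1 $ 2)) / automorphy \<gamma> \<tau>"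

definition SL2Z_orbit :: "complex \<Rightarrow> complex set" where
  "SL2Z_orbit \<tau> = (\<lambda>\<gamma>. SL2Z_act \<gamma> \<tau>) ` SL2Z"

definition fundamental_domain :: "complex set \<Rightarrow> bool" where
  "fundamental_domain F \<longleftrightarrow>
     F \<subseteq> upper_half_plane \<and> (\<forall>\<tau>\<in>upper_half_plane. \<exists>!w. w \<in> F \<inter> SL2Z_orbit \<tau>)"

(* The form [a, b, c] is encoded as the triple (a, b, c). *)
definition quadratic_forms :: "int \<Rightarrow> (int \<times> int \<times> int) set" where
  "quadratic_forms D = {(a, b, c). b\<^sup>2 - 4 * a * c = D}"

definition geodesic :: "int \<times> int \<times> int \<Rightarrow> complex set" where
  "geodesic = (\<lambda>(a, b, c).
     {\<tau> \<in> upper_half_plane. of_int a * (cmod \<tau>)\<^sup>2 + of_int b * Re \<tau> + of_int c = 0})"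

definition exceptional_set :: "int \<Rightarrow> complex set" where
  "exceptional_set D = (\<Union>Q\<in>quadratic_forms D. geodesic Q)"

definition local_polynomial :: "complex set \<Rightarrow> (complex \<Rightarrow> complex) \<Rightarrow> bool" where
  "local_polynomial E P \<longleftrightarrow>
     (\<forall>C\<in>components (upper_half_plane - E). \<exists>p. \<forall>\<tau>\<in>C. P \<tau> = poly p \<tau>)"

(* The frontier is taken in the complex plane; as only points of the upper half-plane are
   tested, and this is open, the frontier relative to it would give the same set. *)
definition adjacent_components :: "complex set \<Rightarrow> complex \<Rightarrow> complex set set" where
  "adjacent_components E \<tau> =
     {C \<in> components (upper_half_plane - E). \<tau> \<in> C \<union> frontier C}"

definition average_exists :: "complex set \<Rightarrow> (complex \<Rightarrow> complex) \<Rightarrow> complex \<Rightarrow> bool" where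
  "average_exists E P \<tau> \<longleftrightarrow>
     finite (adjacent_components E \<tau>) \<and> adjacent_components E \<tau> \<noteq> {} \<and>
     (\<forall>C\<in>adjacent_components E \<tau>. \<exists>l. (P \<longlongrightarrow> l) (at \<tau> within C))"

definition average :: "complex set \<Rightarrow> (complex \<Rightarrow> complex) \<Rightarrow> complex \<Rightarrow> complex" where
  "average E P \<tau> =
     1 / of_nat (card (adjacent_components E \<tau>)) *
     (\<Sum>C\<in>adjacent_components E \<tau>. Lim (at \<tau> within C) P)"

definition slash :: "int \<Rightarrow> int ^ 2 ^ 2 \<Rightarrow> (complex \<Rightarrow> complex) \<Rightarrow> complex \<Rightarrow> complex" where
  "slash k \<gamma> P \<tau> = automorphy \<gamma> \<tau> powi (- k) * P (SL2Z_act \<gamma> \<tau>)"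

(* Functions on the upper half-plane are represented by their extension by zero to the complex
   plane, so that distinct elements of this set are distinct functions on the upper half-plane. *)
definition modular_local_polynomials :: "int \<Rightarrow> complex set \<Rightarrow> (complex \<Rightarrow> complex) set" where
  "modular_local_polynomials k E =
     {P. (\<forall>\<tau>. \<tau> \<notin> upper_half_plane \<longrightarrow> P \<tau> = 0) \<and>
         (\<forall>\<gamma>\<in>SL2Z. \<forall>\<tau>\<in>upper_half_plane. slash k \<gamma> P \<tau> = P \<tau>) \<and>
         local_polynomial E P \<and>
         (\<forall>\<tau>\<in>upper_half_plane. average_exists E P \<tau> \<and> P \<tau> = average E P \<tau>)}"

definition fun_scale :: "complex \<Rightarrow> (complex \<Rightarrow> complex) \<Rightarrow> complex \<Rightarrow> complex" where
  "fun_scale c f = (\<lambda>\<tau>. c * f \<tau>)"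

interpretation cfun: vector_space fun_scale
  by unfold_locales (auto simp: fun_scale_def fun_eq_iff algebra_simps)

(* The card and dim of the libraries are 0 in the infinite case; here the value is \<infinity>. *)
definition ecard :: "'a set \<Rightarrow> enat" where
  "ecard A = (if finite A then enat (card A) else \<infinity>)"

definition edim :: "(complex \<Rightarrow> complex) set \<Rightarrow> enat" where
  "edim V = (if \<exists>B. finite B \<and> V \<subseteq> cfun.span B then enat (cfun.dim V) else \<infinity>)"

definition num_components_meeting :: "int \<Rightarrow> complex set \<Rightarrow> enat" where
  "num_components_meeting D F =
     ecard {C \<in> components (upper_half_plane - exceptional_set D). C \<inter> F \<noteq> {}}"

lemma automorphy_nonzero:
  assumes "\<gamma> \<in> SL2Z" "\<tau> \<in> upper_half_plane"
  shows "automorphy \<gamma> \<tau> \<noteq> 0"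
proof
  assume h: "automorphy \<gamma> \<tau> = 0"
  then have "\<gamma> $ 2 $ 1 = 0"
    using assms(2) by (auto simp: automorphy_def upper_half_plane_def complex_eq_iff)
  with h have "\<gamma> $ 2 $ 2 = 0" by (simp add: automorphy_def)
  with \<open>\<gamma> $ 2 $ 1 = 0\<close> show False using assms(1) by (simp add: SL2Z_def det_2)
qed

lemma Im_SL2Z_act:
  assumes "\<gamma> \<in> SL2Z"
  shows "Im (SL2Z_act \<gamma> \<tau>) = Im \<tau> / (cmod (automorphy \<gamma> \<tau>))\<^sup>2"
proof -
  have "real_of_int (\<gamma>$1$1 * \<gamma>$2$2 - \<gamma>$1$2 * \<gamma>$2$1) = 1"
    using assms by (simp only: SL2Z_def det_2 mem_Collect_eq of_int_1)
  then have "real_of_int (\<gamma>$1$1) * real_of_int (\<gamma>$2$2) = 1 + real_of_int (\<gamma>$1$2) * real_of_int (\<gamma>$2$1)"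
    by simp
  then have "Im \<tau> * (real_of_int (\<gamma>$1$1) * real_of_int (\<gamma>$2$2)) =
        Im \<tau> * (1 + real_of_int (\<gamma>$1$2) * real_of_int (\<gamma>$2$1))"
    by simp
  then show ?thesis
    by (simp add: SL2Z_act_def automorphy_def Im_divide cmod_power2 algebra_simps)
qed

lemma SL2Z_act_in_upper_half_plane:
  assumes "\<gamma> \<in> SL2Z" "\<tau> \<in> upper_half_plane"
  shows "SL2Z_act \<gamma> \<tau> \<in> upper_half_plane"
  using assms automorphy_nonzero[OF assms] by (simp add: upper_half_plane_def Im_SL2Z_act)

lemma SL2Z_mult: "\<gamma> \<in> SL2Z \<Longrightarrow> \<delta> \<in> SL2Z \<Longrightarrow> \<gamma> ** \<delta> \<in> SL2Z"
  by (simp add: SL2Z_def det_mul)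

lemma SL2Z_act_mult:
  assumes "\<gamma> \<in> SL2Z" "\<delta> \<in> SL2Z" "\<tau> \<in> upper_half_plane"
  shows "SL2Z_act (\<gamma> ** \<delta>) \<tau> = SL2Z_act \<gamma> (SL2Z_act \<delta> \<tau>)"
proof -
  have 1: "automorphy \<delta> \<tau> \<noteq> 0" using assms by (simp add: automorphy_nonzero)
  have 2: "automorphy (\<gamma> ** \<delta>) \<tau> = automorphy \<gamma> (SL2Z_act \<delta> \<tau>) * automorphy \<delta> \<tau>"
    using 1 unfolding SL2Z_act_def
    by (simp add: automorphy_def matrix_matrix_mult_def sum_2 field_simps)
  have 3: "of_int ((\<gamma> ** \<delta>)$1$1) * \<tau> + of_int ((\<gamma> ** \<delta>)$1$2)
      = (of_int (\<gamma>$1$1) * SL2Z_act \<delta> \<tau> + of_int (\<gamma>$1$2)) * automorphy \<delta> \<tau>"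
    using 1 unfolding SL2Z_act_def
    by (simp add: automorphy_def matrix_matrix_mult_def sum_2 field_simps)
  show ?thesis
    unfolding SL2Z_act_def[of "\<gamma> ** \<delta>"] SL2Z_act_def[of \<gamma>] 2 3 using 1 by simp
qed

lemma SL2Z_inverse:
  assumes "\<gamma> \<in> SL2Z"
  obtains \<delta> where "\<delta> \<in> SL2Z" "\<And>\<tau>. \<tau> \<in> upper_half_plane \<Longrightarrow> SL2Z_act \<delta> (SL2Z_act \<gamma> \<tau>) = \<tau>"
proof -
  define \<delta> :: "int^2^2" where
    "\<delta> = vector [vector [\<gamma>$2$2, - \<gamma>$1$2], vector [- \<gamma>$2$1, \<gamma>$1$1]]"
  have d: "\<gamma>$1$1 * \<gamma>$2$2 - \<gamma>$1$2 * \<gamma>$2$1 = 1" using assms by (simp add: SL2Z_def det_2)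
  have \<delta>: "\<delta> \<in> SL2Z" using d by (simp add: SL2Z_def det_2 \<delta>_def algebra_simps)
  have id: "\<delta> ** \<gamma> = mat 1"
    using d by (simp add: vec_eq_iff forall_2 matrix_matrix_mult_def sum_2 mat_def \<delta>_def algebra_simps)
  have "SL2Z_act \<delta> (SL2Z_act \<gamma> \<tau>) = \<tau>" if "\<tau> \<in> upper_half_plane" for \<tau>
    using SL2Z_act_mult[OF \<delta> assms that] unfolding id
    by (simp add: SL2Z_act_def automorphy_def mat_def)
  with \<delta> show ?thesis by (rule that)
qed

lemma fundamental_domain_exists: "\<exists>F. fundamental_domain F"
proof -
  have sub: "SL2Z_orbit (SL2Z_act \<gamma> \<tau>) \<subseteq> SL2Z_orbit \<tau>"
    if "\<gamma> \<in> SL2Z" "\<tau> \<in> upper_half_plane" for \<gamma> \<tau>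
    using that by (auto simp: SL2Z_orbit_def SL2Z_act_mult[symmetric] SL2Z_mult)
  have eq: "SL2Z_orbit w = SL2Z_orbit \<tau>"
    if w: "w \<in> SL2Z_orbit \<tau>" and \<tau>: "\<tau> \<in> upper_half_plane" for w \<tau>
  proof -
    obtain \<gamma> where g: "\<gamma> \<in> SL2Z" "w = SL2Z_act \<gamma> \<tau>" using w by (auto simp: SL2Z_orbit_def)
    obtain \<delta> where d: "\<delta> \<in> SL2Z" "SL2Z_act \<delta> w = \<tau>" using SL2Z_inverse[OF g(1)] g(2) \<tau> by metis
    show ?thesis
      using sub[OF g(1) \<tau>] sub[OF d(1), of w] d(2) g SL2Z_act_in_upper_half_plane[OF g(1) \<tau>] by auto
  qed
  have self: "\<tau> \<in> SL2Z_orbit \<tau>" for \<tau>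
  proof -
    have "SL2Z_act (mat 1) \<tau> = \<tau>" by (simp add: SL2Z_act_def automorphy_def mat_def)
    moreover have "mat 1 \<in> SL2Z" by (simp add: SL2Z_def)
    ultimately show ?thesis unfolding SL2Z_orbit_def by (metis image_eqI)
  qed
  define r where "r \<tau> = (SOME w. w \<in> SL2Z_orbit \<tau>)" for \<tau>
  have r: "r \<tau> \<in> SL2Z_orbit \<tau>" for \<tau> unfolding r_def using self by (rule someI)
  have r_eq: "r w = r \<tau>" if "w \<in> SL2Z_orbit \<tau>" "\<tau> \<in> upper_half_plane" for w \<tau>
    unfolding r_def using eq[OF that] by simp
  have orb: "SL2Z_orbit \<tau> \<subseteq> upper_half_plane" if "\<tau> \<in> upper_half_plane" for \<tau>
    using that by (auto simp: SL2Z_orbit_def SL2Z_act_in_upper_half_plane)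
  have "fundamental_domain (r ` upper_half_plane)"
    unfolding fundamental_domain_def
  proof (intro conjI ballI)
    show "r ` upper_half_plane \<subseteq> upper_half_plane" using r orb by blast
    fix \<tau> assume t: "\<tau> \<in> upper_half_plane"
    show "\<exists>!w. w \<in> r ` upper_half_plane \<inter> SL2Z_orbit \<tau>"
    proof (rule ex1I[of _ "r \<tau>"])
      show "r \<tau> \<in> r ` upper_half_plane \<inter> SL2Z_orbit \<tau>" using r t by blast
    next
      fix w assume "w \<in> r ` upper_half_plane \<inter> SL2Z_orbit \<tau>"
      then obtain s where s: "s \<in> upper_half_plane" "w = r s" "r s \<in> SL2Z_orbit \<tau>" by blast
      have "r (r s) = r s" using r_eq[OF r s(1)] .
      moreover have "r (r s) = r \<tau>" using r_eq[OF s(3) t] .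
      ultimately show "w = r \<tau>" using s(2) by simp
    qed
  qed
  then show ?thesis by blast
qed

lemma minimum_attained:
  "\<exists>F. fundamental_domain F \<and>
     num_components_meeting D F = (INF F\<in>{F. fundamental_domain F}. num_components_meeting D F)"
proof -
  let ?A = "num_components_meeting D ` {F. fundamental_domain F}"
  have "?A \<noteq> {}" using fundamental_domain_exists by blast
  then have "Inf ?A \<in> ?A" by (rule wellorder_InfI[OF someI_ex[OF ex_in_conv[THEN iffD2]]])
  then show ?thesis by auto
qed

end

theory Submission
  imports Defs
begin

text \<open>
  Let \<open>n = \<bar>k\<bar>\<close>, and call points of one orbit equivalent. The theorem is proved by comparing a modular
  local polynomial with the polynomials that it induces on the components off the exceptional set.

  Comparing the polynomials on \<open>C\<close> and on its image under \<open>\<tau> \<mapsto> -1/\<tau>\<close> shows that the polynomial on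
  each component \<open>C\<close> has degree at most \<open>n\<close> (\<open>modular_local_polynomial_on_comp\<close>), so \<open>n + 1\<close> values
  determine it. Equivariance propagates values along orbits, and averaging determines them on
  the exceptional set. Call a family \<open>R\<close> of components covering if each orbit off the exceptional
  set meets one of them. Then the dimension is at most \<open>(n + 1) card R\<close> (\<open>edim_le\<close>). The components that
  meet a fundamental domain form a covering family. Conversely, as a fundamental domain is an arbitrary
  choice of one point from each orbit, that choice can be made inside any given covering family
  (\<open>fundamental_domain_of_covering\<close>). So the minimum in the theorem is the least size of a covering
  family; it is finite, because the orbits meet the half strip \<open>\<bar>Re \<tau>\<bar> \<le> 1, Im \<tau> \<ge> 1/2\<close>, which meets only
  finitely many components (\<open>finite_components_meeting_half_strip\<close>).

  Whether the bound for a least family is attained is decided by the stabilisers of the components. If some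
  component contains two distinct equivalent points, the value at one of them determines the value at the
  other, and the dimension is strictly smaller (\<open>edim_less\<close>). If no component does, then every
  polynomial of degree at most \<open>n\<close> on one component extends equivariantly to its translates
  (\<open>modular_extension\<close>), the components of a least family can be prescribed independently, and equality
  holds (\<open>edim_ge\<close>).

  It remains to decide when a component contains two distinct equivalent points. If \<open>D\<close> is not a square,
  the component near the cusp is invariant under \<open>\<tau> \<mapsto> \<tau> + 1\<close>. If \<open>D\<close> is odd, the elliptic point of
  order three is not exceptional, and its component is invariant under a rotation around it. If
  \<open>D = 4m\<^sup>2\<close>, the boundary of the standard fundamental domain is exceptional, so each component
  lies in the interior of one of its translates, which contains no two distinct equivalent points.
\<close>


section \<open>Moebius action of the modular group\<close>

lemma automorphy_mult:
  assumes "\<delta> \<in> SL2Z" "\<tau> \<in> upper_half_plane"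
  shows "automorphy (\<gamma> ** \<delta>) \<tau> = automorphy \<gamma> (SL2Z_act \<delta> \<tau>) * automorphy \<delta> \<tau>"
  using automorphy_nonzero[OF assms] unfolding SL2Z_act_def
  by (simp add: automorphy_def matrix_matrix_mult_def sum_2 field_simps)

lemma SL2Z_inverse_both:
  assumes "\<gamma> \<in> SL2Z"
  obtains \<delta> where "\<delta> \<in> SL2Z"
    and "\<And>\<tau>. \<tau> \<in> upper_half_plane \<Longrightarrow> SL2Z_act \<delta> (SL2Z_act \<gamma> \<tau>) = \<tau>"
    and "\<And>\<tau>. \<tau> \<in> upper_half_plane \<Longrightarrow> SL2Z_act \<gamma> (SL2Z_act \<delta> \<tau>) = \<tau>"
proof -
  obtain \<delta> where \<delta>: "\<delta> \<in> SL2Z"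
    "\<And>\<tau>. \<tau> \<in> upper_half_plane \<Longrightarrow> SL2Z_act \<delta> (SL2Z_act \<gamma> \<tau>) = \<tau>"
    using SL2Z_inverse[OF assms] by metis
  obtain \<epsilon> where \<epsilon>:
    "\<And>\<tau>. \<tau> \<in> upper_half_plane \<Longrightarrow> SL2Z_act \<epsilon> (SL2Z_act \<delta> \<tau>) = \<tau>"
    using SL2Z_inverse[OF \<delta>(1)] by metis
  have "SL2Z_act \<gamma> (SL2Z_act \<delta> \<tau>) = \<tau>" if "\<tau> \<in> upper_half_plane" for \<tau>
    by (metis \<delta> \<epsilon> assms that SL2Z_act_in_upper_half_plane)
  with \<delta> show ?thesis by (rule that)
qed

lemma SL2Z_act_inj:
  assumes "\<gamma> \<in> SL2Z" "z \<in> upper_half_plane" "w \<in> upper_half_plane" "SL2Z_act \<gamma> z = SL2Z_act \<gamma> w"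
  shows "z = w"
  using assms SL2Z_inverse by metis

lemma mem_SL2Z_orbit: "\<gamma> \<in> SL2Z \<Longrightarrow> SL2Z_act \<gamma> \<tau> \<in> SL2Z_orbit \<tau>"
  by (auto simp: SL2Z_orbit_def)

lemma SL2Z_orbitE:
  assumes "w \<in> SL2Z_orbit \<tau>"
  obtains \<gamma> where "\<gamma> \<in> SL2Z" "w = SL2Z_act \<gamma> \<tau>"
  using assms by (auto simp: SL2Z_orbit_def)

lemma SL2Z_orbit_subset_upper_half_plane:
  "\<tau> \<in> upper_half_plane \<Longrightarrow> w \<in> SL2Z_orbit \<tau> \<Longrightarrow> w \<in> upper_half_plane"
  by (auto simp: SL2Z_orbit_def SL2Z_act_in_upper_half_plane)

lemma SL2Z_orbit_refl: "\<tau> \<in> SL2Z_orbit \<tau>"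
proof -
  have "SL2Z_act (mat 1) \<tau> = \<tau>" by (simp add: SL2Z_act_def automorphy_def mat_def)
  moreover have "mat 1 \<in> SL2Z" by (simp add: SL2Z_def)
  ultimately show ?thesis unfolding SL2Z_orbit_def by (metis image_eqI)
qed

lemma SL2Z_orbit_eq:
  assumes w: "w \<in> SL2Z_orbit \<tau>" and \<tau>: "\<tau> \<in> upper_half_plane"
  shows "SL2Z_orbit w = SL2Z_orbit \<tau>"
proof -
  have sub: "SL2Z_orbit (SL2Z_act \<gamma> z) \<subseteq> SL2Z_orbit z"
    if "\<gamma> \<in> SL2Z" "z \<in> upper_half_plane" for \<gamma> z
    using that by (auto simp: SL2Z_orbit_def SL2Z_act_mult[symmetric] SL2Z_mult)
  obtain \<gamma> where g: "\<gamma> \<in> SL2Z" "w = SL2Z_act \<gamma> \<tau>" using w by (rule SL2Z_orbitE)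
  obtain \<delta> where d: "\<delta> \<in> SL2Z" "SL2Z_act \<delta> w = \<tau>" using SL2Z_inverse[OF g(1)] g(2) \<tau> by metis
  show ?thesis
    using sub[OF g(1) \<tau>] sub[OF d(1), of w] d(2) g SL2Z_act_in_upper_half_plane[OF g(1) \<tau>] by auto
qed

lemma SL2Z_orbit_sym:
  "w \<in> SL2Z_orbit \<tau> \<Longrightarrow> \<tau> \<in> upper_half_plane \<Longrightarrow> \<tau> \<in> SL2Z_orbit w"
  by (metis SL2Z_orbit_eq SL2Z_orbit_refl)

lemma continuous_on_SL2Z_act:
  assumes "\<gamma> \<in> SL2Z"
  shows "continuous_on upper_half_plane (SL2Z_act \<gamma>)"
proof -
  have "continuous_on upper_half_plane
     (\<lambda>\<tau>. (of_int (\<gamma> $ 1 $ 1) * \<tau> + of_int (\<gamma> $ 1 $ 2)) / automorphy \<gamma> \<tau>)"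
    using automorphy_nonzero[OF assms]
    by (auto simp: automorphy_def intro!: continuous_intros)
  then show ?thesis by (simp add: SL2Z_act_def)
qed

lemma open_upper_half_plane: "open upper_half_plane"
  unfolding upper_half_plane_def by (rule open_halfspace_Im_gt)

lemma isCont_SL2Z_act:
  "\<gamma> \<in> SL2Z \<Longrightarrow> \<tau> \<in> upper_half_plane \<Longrightarrow> isCont (SL2Z_act \<gamma>) \<tau>"
  using continuous_on_SL2Z_act continuous_on_eq_continuous_at open_upper_half_plane by blast

lemma SL2Z_act_diff:
  assumes g: "\<gamma> \<in> SL2Z" and "z \<in> upper_half_plane" "w \<in> upper_half_plane"
  shows "SL2Z_act \<gamma> z - SL2Z_act \<gamma> w = (z - w) / (automorphy \<gamma> z * automorphy \<gamma> w)"
proof -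
  have nz: "automorphy \<gamma> z \<noteq> 0" "automorphy \<gamma> w \<noteq> 0" using assms automorphy_nonzero by auto
  have "of_int (\<gamma>$1$1 * \<gamma>$2$2 - \<gamma>$1$2 * \<gamma>$2$1) = (1::complex)"
    using g by (simp only: SL2Z_def det_2 mem_Collect_eq of_int_1)
  then have d: "of_int (\<gamma>$1$1) * of_int (\<gamma>$2$2) - of_int (\<gamma>$1$2) * of_int (\<gamma>$2$1) = (1::complex)"
    by simp
  have "(of_int (\<gamma>$1$1) * z + of_int (\<gamma>$1$2)) * automorphy \<gamma> w
      - (of_int (\<gamma>$1$1) * w + of_int (\<gamma>$1$2)) * automorphy \<gamma> z
    = (z - w) * (of_int (\<gamma>$1$1) * of_int (\<gamma>$2$2) - of_int (\<gamma>$1$2) * of_int (\<gamma>$2$1))"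
    by (simp add: automorphy_def algebra_simps)
  also have "\<dots> = z - w" by (simp add: d)
  finally show ?thesis using nz unfolding SL2Z_act_def by (simp add: field_simps)
qed

text \<open>The squared automorphy factor is the reciprocal of the derivative of the action, so it is
  determined by the action near a point. Three points suffice: the differences of the
  images determine the pairwise products of the factors.\<close>

lemma automorphy_square_eq:
  assumes g: "\<gamma> \<in> SL2Z" "\<delta> \<in> SL2Z"
    and H: "x \<in> upper_half_plane" "y \<in> upper_half_plane" "z \<in> upper_half_plane"
    and ne: "x \<noteq> y" "y \<noteq> z" "x \<noteq> z"
    and eq: "SL2Z_act \<gamma> x = SL2Z_act \<delta> x" "SL2Z_act \<gamma> y = SL2Z_act \<delta> y"
      "SL2Z_act \<gamma> z = SL2Z_act \<delta> z"
  shows "(automorphy \<gamma> x)\<^sup>2 = (automorphy \<delta> x)\<^sup>2"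
proof -
  have pair: "automorphy \<gamma> u * automorphy \<gamma> v = automorphy \<delta> u * automorphy \<delta> v"
    if "u \<in> upper_half_plane" "v \<in> upper_half_plane" "u \<noteq> v"
      "SL2Z_act \<gamma> u = SL2Z_act \<delta> u" "SL2Z_act \<gamma> v = SL2Z_act \<delta> v" for u v
  proof -
    have "(u - v) / (automorphy \<gamma> u * automorphy \<gamma> v) = (u - v) / (automorphy \<delta> u * automorphy \<delta> v)"
      using SL2Z_act_diff[OF g(1) that(1,2)] SL2Z_act_diff[OF g(2) that(1,2)] that(4,5) by metis
    then have "(u - v) * (automorphy \<delta> u * automorphy \<delta> v) = (u - v) * (automorphy \<gamma> u * automorphy \<gamma> v)"
      using automorphy_nonzero[OF g(1) that(1)] automorphy_nonzero[OF g(1) that(2)]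
        automorphy_nonzero[OF g(2) that(1)] automorphy_nonzero[OF g(2) that(2)]
      by (auto simp: frac_eq_eq)
    then show ?thesis using that(3) by simp
  qed
  let ?a = "automorphy \<gamma>" and ?b = "automorphy \<delta>"
  have nz: "?a y * ?a z \<noteq> 0" using automorphy_nonzero g H by simp
  have "(?a x)\<^sup>2 * (?a y * ?a z) = (?a x * ?a y) * (?a x * ?a z)"
    by (simp add: power2_eq_square)
  also have "\<dots> = (?b x * ?b y) * (?b x * ?b z)"
    using pair H ne eq by simp
  also have "\<dots> = (?b x)\<^sup>2 * (?b y * ?b z)" by (simp add: power2_eq_square)
  also have "\<dots> = (?b x)\<^sup>2 * (?a y * ?a z)" using pair H ne eq by simp
  finally show ?thesis using nz by simp
qed

definition mat2 :: "int \<Rightarrow> int \<Rightarrow> int \<Rightarrow> int \<Rightarrow> int ^ 2 ^ 2" where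
  "mat2 a b c d = vector [vector [a, b], vector [c, d]]"

lemma mat2_in_SL2Z: "a * d - b * c = 1 \<Longrightarrow> mat2 a b c d \<in> SL2Z"
  by (simp add: SL2Z_def mat2_def det_2)

lemma automorphy_mat2: "automorphy (mat2 a b c d) \<tau> = of_int c * \<tau> + of_int d"
  by (simp add: automorphy_def mat2_def)

lemma SL2Z_act_mat2:
  "SL2Z_act (mat2 a b c d) \<tau> = (of_int a * \<tau> + of_int b) / (of_int c * \<tau> + of_int d)"
  by (simp add: SL2Z_act_def automorphy_mat2) (simp add: mat2_def)

section \<open>Reduction to the standard fundamental domain\<close>

text \<open>Since \<open>Im (\<gamma>\<tau>) = Im \<tau> / \<bar>c\<tau> + d\<bar>\<^sup>2\<close>, these are the bottom rows that do not lower the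
  imaginary part. Their finiteness yields a point of maximal imaginary part in each orbit.\<close>

lemma finite_automorphy_le_1:
  assumes "\<tau> \<in> upper_half_plane"
  shows "finite {(c::int, d::int). cmod (of_int c * \<tau> + of_int d) \<le> 1}"
proof -
  have y: "Im \<tau> > 0" using assms by (simp add: upper_half_plane_def)
  define M where "M = \<lceil>1 / Im \<tau>\<rceil>"
  define N where "N = \<lceil>1 + \<bar>of_int M\<bar> * \<bar>Re \<tau>\<bar>\<rceil>"
  have "c \<in> {-M..M} \<and> d \<in> {-N..N}" if h: "cmod (of_int c * \<tau> + of_int d) \<le> 1" for c d :: int
  proof -
    have "\<bar>of_int c * Im \<tau>\<bar> \<le> 1"
      using abs_Im_le_cmod[of "of_int c * \<tau> + of_int d"] h by simp
    then have "\<bar>of_int c\<bar> \<le> 1 / Im \<tau>" using y by (simp add: abs_mult field_simps)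
    then have c: "of_int \<bar>c\<bar> \<le> (of_int M :: real)" unfolding M_def by (simp add: le_of_int_ceiling order_trans)
    then have c': "\<bar>c\<bar> \<le> M" using of_int_le_iff by blast
    have "\<bar>of_int c * Re \<tau> + of_int d\<bar> \<le> 1"
      using abs_Re_le_cmod[of "of_int c * \<tau> + of_int d"] h by simp
    then have "\<bar>of_int d\<bar> \<le> 1 + \<bar>of_int c\<bar> * \<bar>Re \<tau>\<bar>" using abs_mult[of "of_int c" "Re \<tau>"] by linarith
    also have "\<dots> \<le> 1 + \<bar>of_int M\<bar> * \<bar>Re \<tau>\<bar>" using c by (intro add_left_mono mult_right_mono) auto
    also have "\<dots> \<le> of_int N" unfolding N_def by (rule le_of_int_ceiling)
    finally have "\<bar>d\<bar> \<le> N" by linarith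
    with c' show ?thesis by auto
  qed
  then have "{(c, d). cmod (of_int c * \<tau> + of_int d) \<le> 1} \<subseteq> {-M..M} \<times> {-N..N}" by auto
  then show ?thesis by (rule finite_subset) auto
qed

lemma SL2Z_act_maximal_Im:
  assumes \<tau>: "\<tau> \<in> upper_half_plane"
  obtains \<gamma> where "\<gamma> \<in> SL2Z" "\<And>\<delta>. \<delta> \<in> SL2Z \<Longrightarrow> Im (SL2Z_act \<delta> \<tau>) \<le> Im (SL2Z_act \<gamma> \<tau>)"
proof -
  have y: "Im \<tau> > 0" using assms by (simp add: upper_half_plane_def)
  define A where "A = {\<gamma> \<in> SL2Z. cmod (automorphy \<gamma> \<tau>) \<le> 1}"
  define I where "I = (\<lambda>\<gamma>. Im (SL2Z_act \<gamma> \<tau>)) ` A"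
  have "I \<subseteq> (\<lambda>(c, d). Im \<tau> / (cmod (of_int c * \<tau> + of_int d))\<^sup>2) `
      {(c, d). cmod (of_int c * \<tau> + of_int d) \<le> 1}"
    unfolding I_def A_def by (force simp: Im_SL2Z_act automorphy_def)
  then have fin: "finite I" using finite_automorphy_le_1[OF \<tau>] finite_surj by blast
  have "mat 1 \<in> SL2Z" by (simp add: SL2Z_def)
  then have one: "mat 1 \<in> A" by (simp add: A_def automorphy_def mat_def)
  then have ne: "I \<noteq> {}" by (auto simp: I_def)
  obtain \<gamma> where g: "\<gamma> \<in> A" "Im (SL2Z_act \<gamma> \<tau>) = Max I"
    using Max_in[OF fin ne] by (auto simp: I_def)
  have "Im (SL2Z_act \<delta> \<tau>) \<le> Max I" if d: "\<delta> \<in> SL2Z" for \<delta>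
  proof (cases "\<delta> \<in> A")
    case True
    then show ?thesis using fin by (auto simp: I_def)
  next
    case False
    then have "1 < cmod (automorphy \<delta> \<tau>)" using d by (auto simp: A_def)
    then have "1 < (cmod (automorphy \<delta> \<tau>))\<^sup>2" by (simp add: one_less_power)
    then have "Im (SL2Z_act \<delta> \<tau>) \<le> Im \<tau>" using d y divide_left_mono[of 1 "(cmod (automorphy \<delta> \<tau>))\<^sup>2" "Im \<tau>"]
        automorphy_nonzero[OF d \<tau>]
      by (simp add: Im_SL2Z_act)
    also have "Im \<tau> = Im (SL2Z_act (mat 1) \<tau>)" by (simp add: SL2Z_act_def automorphy_def mat_def)
    also have "\<dots> \<le> Max I" using fin one by (auto simp: I_def)
    finally show ?thesis .
  qed
  with g show ?thesis by (intro that[of \<gamma>]) (auto simp: A_def)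
qed

lemma SL2Z_reduction:
  assumes \<tau>: "\<tau> \<in> upper_half_plane"
  obtains \<gamma> where "\<gamma> \<in> SL2Z" "\<bar>Re (SL2Z_act \<gamma> \<tau>)\<bar> \<le> 1 / 2" "cmod (SL2Z_act \<gamma> \<tau>) \<ge> 1"
proof -
  obtain \<gamma> where g: "\<gamma> \<in> SL2Z" and max: "\<And>\<delta>. \<delta> \<in> SL2Z \<Longrightarrow> Im (SL2Z_act \<delta> \<tau>) \<le> Im (SL2Z_act \<gamma> \<tau>)"
    using SL2Z_act_maximal_Im[OF \<tau>] by blast
  define n where "n = - round (Re (SL2Z_act \<gamma> \<tau>))"
  define T where "T = mat2 1 n 0 1"
  define S where "S = mat2 0 (-1) 1 0"
  have ST: "T \<in> SL2Z" "S \<in> SL2Z" by (simp_all add: T_def S_def mat2_in_SL2Z)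
  define w where "w = SL2Z_act (T ** \<gamma>) \<tau>"
  have w: "w = SL2Z_act \<gamma> \<tau> + of_int n"
    using SL2Z_act_mult[OF ST(1) g \<tau>] by (simp add: w_def T_def SL2Z_act_mat2)
  have Tg: "T ** \<gamma> \<in> SL2Z" using ST g SL2Z_mult by blast
  have "w \<in> upper_half_plane" unfolding w_def by (rule SL2Z_act_in_upper_half_plane[OF Tg \<tau>])
  then have wp: "Im w > 0" "w \<noteq> 0" by (auto simp: upper_half_plane_def)
  have Re: "\<bar>Re w\<bar> \<le> 1 / 2"
    using of_int_round_abs_le[of "Re (SL2Z_act \<gamma> \<tau>)"] by (simp add: w n_def abs_minus_commute)
  have "Im (SL2Z_act (S ** (T ** \<gamma>)) \<tau>) \<le> Im w"
    using max[OF SL2Z_mult[OF ST(2) Tg]] w by simp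
  moreover have "SL2Z_act (S ** (T ** \<gamma>)) \<tau> = SL2Z_act S w"
    unfolding w_def by (rule SL2Z_act_mult[OF ST(2) Tg \<tau>])
  ultimately have "Im w / (cmod w)\<^sup>2 \<le> Im w"
    using Im_SL2Z_act[OF ST(2), of w] by (simp add: S_def automorphy_mat2)
  then have "(cmod w)\<^sup>2 \<ge> 1\<^sup>2" using wp by (simp add: field_simps)
  then have "cmod w \<ge> 1" using power2_le_imp_le norm_ge_zero by blast
  with Re show ?thesis by (intro that[OF Tg]) (auto simp: w_def)
qed

lemma SL2Z_reduction_half_strip:
  assumes \<tau>: "\<tau> \<in> upper_half_plane"
  shows "\<exists>w\<in>SL2Z_orbit \<tau>. \<bar>Re w\<bar> \<le> 1 \<and> Im w \<ge> 1 / 2"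
proof -
  obtain \<gamma> where g: "\<gamma> \<in> SL2Z" "\<bar>Re (SL2Z_act \<gamma> \<tau>)\<bar> \<le> 1 / 2" "cmod (SL2Z_act \<gamma> \<tau>) \<ge> 1"
    using SL2Z_reduction[OF \<tau>] .
  define w where "w = SL2Z_act \<gamma> \<tau>"
  have w: "\<bar>Re w\<bar> \<le> 1 / 2" "cmod w \<ge> 1" "Im w > 0"
    using g SL2Z_act_in_upper_half_plane[OF g(1) \<tau>] by (auto simp: w_def upper_half_plane_def)
  have "\<bar>Re w\<bar> + \<bar>Im w\<bar> \<ge> 1" using cmod_le[of w] w(2) by linarith
  then have "Im w \<ge> 1 / 2" using w by linarith
  then show ?thesis using w g mem_SL2Z_orbit[OF g(1), of \<tau>] by (intro bexI[of _ w]) (auto simp: w_def)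
qed

text \<open>On the interior of the standard fundamental domain every matrix with \<open>c \<noteq> 0\<close> strictly lowers
  the imaginary part, since
  \<open>\<bar>c\<tau> + d\<bar>\<^sup>2 = c\<^sup>2\<bar>\<tau>\<bar>\<^sup>2 + 2cd Re \<tau> + d\<^sup>2 > c\<^sup>2 - \<bar>cd\<bar> + d\<^sup>2 \<ge> 1\<close>.\<close>

lemma Im_SL2Z_act_less:
  assumes g: "\<gamma> \<in> SL2Z" "\<gamma> $ 2 $ 1 \<noteq> 0"
    and z: "Im z > 0" "\<bar>Re z\<bar> < 1 / 2" "cmod z > 1"
  shows "Im (SL2Z_act \<gamma> z) < Im z"
proof -
  define c d where "c = \<gamma> $ 2 $ 1" and "d = \<gamma> $ 2 $ 2"
  have c: "c \<noteq> 0" using g by (simp add: c_def)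
  have "1 \<le> c\<^sup>2 - \<bar>c * d\<bar> + d\<^sup>2"
  proof -
    have "c\<^sup>2 - \<bar>c * d\<bar> + d\<^sup>2 = (\<bar>c\<bar> - \<bar>d\<bar>)\<^sup>2 + \<bar>c\<bar> * \<bar>d\<bar>"
      by (simp add: power2_eq_square algebra_simps abs_mult)
    moreover have "(\<bar>c\<bar> - \<bar>d\<bar>)\<^sup>2 + \<bar>c\<bar> * \<bar>d\<bar> > 0"
    proof (cases "d = 0")
      case True
      then show ?thesis using c by simp
    next
      case False
      then have "\<bar>c\<bar> * \<bar>d\<bar> > 0" using c by simp
      then show ?thesis using zero_le_power2[of "\<bar>c\<bar> - \<bar>d\<bar>"] by linarith
    qed
    ultimately show ?thesis by linarith
  qed
  then have i1: "(1::real) \<le> (of_int c)\<^sup>2 - \<bar>of_int c * of_int d\<bar> + (of_int d)\<^sup>2"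
    by (metis (mono_tags, opaque_lifting) of_int_abs of_int_add of_int_diff of_int_le_iff of_int_1 of_int_mult of_int_power)
  have z2: "(Re z)\<^sup>2 + (Im z)\<^sup>2 > 1"
    using z(3) one_less_power[of "cmod z" 2] by (simp add: cmod_power2)
  have "(cmod (automorphy \<gamma> z))\<^sup>2 = (of_int c)\<^sup>2 * ((Re z)\<^sup>2 + (Im z)\<^sup>2) + 2 * (of_int c * of_int d) * Re z + (of_int d)\<^sup>2"
    by (simp add: automorphy_def cmod_power2 c_def[symmetric] d_def[symmetric]) (simp add: power2_eq_square algebra_simps)
  moreover have "(of_int c)\<^sup>2 * ((Re z)\<^sup>2 + (Im z)\<^sup>2) > (of_int c)\<^sup>2 * 1"
    using c z2 by (intro mult_strict_left_mono) auto
  moreover have "2 * (of_int c * of_int d) * Re z \<ge> - \<bar>of_int c * of_int d\<bar>"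
  proof -
    have "\<bar>2 * (of_int c * of_int d) * Re z\<bar> = \<bar>of_int c * of_int d\<bar> * (2 * \<bar>Re z\<bar>)"
      by (simp add: abs_mult)
    also have "\<dots> \<le> \<bar>of_int c * of_int d\<bar> * 1" using z by (intro mult_left_mono) auto
    finally show ?thesis by linarith
  qed
  ultimately have "(cmod (automorphy \<gamma> z))\<^sup>2 > 1" using i1 by linarith
  then show ?thesis
    using z divide_strict_left_mono[of 1 "(cmod (automorphy \<gamma> z))\<^sup>2" "Im z"]
      automorphy_nonzero[OF g(1), of z]
    by (simp add: upper_half_plane_def Im_SL2Z_act[OF g(1)])
qed

lemma interior_fundamental_domain_unique:
  assumes w: "w \<in> SL2Z_orbit z" and z: "Im z > 0"
    and bz: "\<bar>Re z\<bar> < 1 / 2" "cmod z > 1" and bw: "\<bar>Re w\<bar> < 1 / 2" "cmod w > 1"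
  shows "w = z"
proof -
  obtain \<gamma> where g: "\<gamma> \<in> SL2Z" "w = SL2Z_act \<gamma> z" using w by (rule SL2Z_orbitE)
  have zH: "z \<in> upper_half_plane" using z by (simp add: upper_half_plane_def)
  have wH: "w \<in> upper_half_plane" using SL2Z_orbit_subset_upper_half_plane[OF zH w] .
  have det: "\<gamma>$1$1 * \<gamma>$2$2 - \<gamma>$1$2 * \<gamma>$2$1 = 1" using g by (simp add: SL2Z_def det_2)
  have c0: "\<gamma> $ 2 $ 1 = 0"
  proof (rule ccontr)
    assume c: "\<gamma> $ 2 $ 1 \<noteq> 0"
    define \<delta> where "\<delta> = mat2 (\<gamma>$2$2) (- \<gamma>$1$2) (- \<gamma>$2$1) (\<gamma>$1$1)"
    have d: "\<delta> \<in> SL2Z" unfolding \<delta>_def using det by (intro mat2_in_SL2Z) (simp add: algebra_simps)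
    have "\<delta> ** \<gamma> = mat 1"
      using det by (simp add: vec_eq_iff forall_2 matrix_matrix_mult_def sum_2 mat_def \<delta>_def mat2_def algebra_simps)
    then have "SL2Z_act \<delta> w = z"
      using SL2Z_act_mult[OF d g(1) zH] g(2) by (simp add: SL2Z_act_def automorphy_def mat_def)
    moreover have "\<delta> $ 2 $ 1 \<noteq> 0" using c by (simp add: \<delta>_def mat2_def)
    ultimately have "Im z < Im w"
      using Im_SL2Z_act_less[OF d _ _ bw] wH by (simp add: upper_half_plane_def)
    moreover have "Im w < Im z" using Im_SL2Z_act_less[OF g(1) c z bz] g(2) by simp
    ultimately show False by simp
  qed
  define b where "b = \<gamma>$1$2 * \<gamma>$2$2"
  have ad: "\<gamma>$1$1 * \<gamma>$2$2 = 1" using det c0 by simp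
  then have "\<gamma>$1$1 = \<gamma>$2$2 \<and> (\<gamma>$2$2 = 1 \<or> \<gamma>$2$2 = -1)" by (auto simp: zmult_eq_1_iff)
  then have w': "w = z + of_int b" using g(2) c0 by (auto simp: SL2Z_act_def automorphy_def b_def)
  then have "Re w = Re z + of_int b" by simp
  then have "\<bar>of_int b\<bar> < (1::real)" using bz bw by linarith
  then have "b = 0" by linarith
  with w' show ?thesis by simp
qed

section \<open>Spaces of functions and evaluation at finitely many points\<close>

lemma sum_fun_apply: "(\<Sum>x\<in>A. f x) z = (\<Sum>x\<in>A. f x z)"
  for f :: "'a \<Rightarrow> 'b \<Rightarrow> 'c::comm_monoid_add"
  by (induction A rule: infinite_finite_induct) auto

text \<open>Restriction to \<open>Z\<close> embeds the space into the span of the indicator functions of the points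
  of \<open>Z\<close>.\<close>

lemma edim_le_card:
  assumes V: "cfun.subspace V" and Z: "finite Z"
    and vanish: "\<And>f. f \<in> V \<Longrightarrow> (\<forall>z\<in>Z. f z = 0) \<Longrightarrow> f = 0"
  shows "edim V \<le> enat (card Z)"
proof -
  define r where "r f = (\<lambda>z. if z \<in> Z then f z else 0)" for f :: "complex \<Rightarrow> complex"
  define e where "e z = (\<lambda>x. if x = z then 1 else 0 :: complex)" for z :: complex
  interpret vector_space_pair fun_scale fun_scale ..
  interpret r: Vector_Spaces.linear fun_scale fun_scale r
    by unfold_locales (auto simp: r_def fun_scale_def fun_eq_iff)
  obtain B where B: "B \<subseteq> V" "cfun.independent B" "V \<subseteq> cfun.span B" "card B = cfun.dim V"
    using cfun.basis_exists by blast
  have inj: "inj_on r (cfun.span B)"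
  proof (rule inj_onI)
    fix f g assume "f \<in> cfun.span B" "g \<in> cfun.span B" and eq: "r f = r g"
    then have "f - g \<in> V"
      using B(1) V cfun.span_minimal cfun.subspace_diff by blast
    moreover have "\<forall>z\<in>Z. (f - g) z = 0" using eq by (simp add: r_def fun_eq_iff) metis
    ultimately show "f = g" using vanish[of "f - g"] by (simp add: fun_eq_iff)
  qed
  have "r ` B \<subseteq> cfun.span (e ` Z)"
  proof
    fix g assume "g \<in> r ` B"
    then obtain f where f: "g = r f" by blast
    have "g = (\<Sum>z\<in>Z. fun_scale (f z) (e z))"
    proof
      fix x
      have "(\<Sum>z\<in>Z. fun_scale (f z) (e z)) x = (\<Sum>z\<in>Z. fun_scale (f z) (e z) x)"
        by (rule sum_fun_apply)
      also have "\<dots> = (\<Sum>z\<in>Z. if z = x then f z else 0)"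
        by (intro sum.cong) (auto simp: fun_scale_def e_def)
      also have "\<dots> = g x" using Z by (simp add: f r_def)
      finally show "g x = (\<Sum>z\<in>Z. fun_scale (f z) (e z)) x" by simp
    qed
    also have "\<dots> \<in> cfun.span (e ` Z)"
      by (intro cfun.span_sum cfun.span_scale cfun.span_base) auto
    finally show "g \<in> cfun.span (e ` Z)" .
  qed
  moreover have "cfun.independent (r ` B)"
    using linear_independent_injective_image[OF r.linear_axioms B(2) inj] .
  ultimately have fin: "finite (r ` B)" and le: "card (r ` B) \<le> card (e ` Z)"
    using cfun.independent_span_bound[of "e ` Z" "r ` B"] Z by auto
  have injB: "inj_on r B" using inj inj_on_subset cfun.span_superset by blast
  have finB: "finite B" using fin injB finite_imageD by blast
  have "card B \<le> card Z" using le card_image[OF injB] card_image_le[OF Z, of e] by linarith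
  then show ?thesis using finB B unfolding edim_def by auto
qed

lemma card_le_edim:
  assumes Z: "finite Z"
    and dual: "\<And>z. z \<in> Z \<Longrightarrow> \<exists>f\<in>V. \<forall>x\<in>Z. f x = (if x = z then 1 else 0)"
  shows "enat (card Z) \<le> edim V"
proof (cases "\<exists>B. finite B \<and> V \<subseteq> cfun.span B")
  case True
  then obtain B where B: "finite B" "V \<subseteq> cfun.span B" by blast
  obtain C where C: "C \<subseteq> V" "cfun.independent C" "V \<subseteq> cfun.span C" "card C = cfun.dim V"
    using cfun.basis_exists by blast
  have finC: "finite C" using cfun.independent_span_bound[OF B(1) C(2)] C(1) B(2) by blast
  obtain f where f: "\<And>z. z \<in> Z \<Longrightarrow> f z \<in> V"
    "\<And>z x. z \<in> Z \<Longrightarrow> x \<in> Z \<Longrightarrow> f z x = (if x = z then 1 else 0)"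
    using dual by metis
  have inj: "inj_on f Z"
  proof (rule inj_onI)
    fix x y assume "x \<in> Z" "y \<in> Z" "f x = f y"
    then show "x = y" using f(2)[of x x] f(2)[of y x] by (auto split: if_splits)
  qed
  have zero: "c g = 0" if s: "(\<Sum>x\<in>f ` Z. fun_scale (c x) x) = 0" and g: "g \<in> f ` Z" for c g
  proof -
    obtain z where z: "z \<in> Z" "g = f z" using g by blast
    have "(\<Sum>x\<in>Z. fun_scale (c (f x)) (f x)) = 0" using s inj by (simp add: sum.reindex)
    then have "0 = (\<Sum>x\<in>Z. fun_scale (c (f x)) (f x)) z" by simp
    also have "\<dots> = (\<Sum>x\<in>Z. fun_scale (c (f x)) (f x) z)" by (rule sum_fun_apply)
    also have "\<dots> = (\<Sum>x\<in>Z. if x = z then c (f x) else 0)"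
      using f(2) z by (intro sum.cong) (auto simp: fun_scale_def)
    finally show ?thesis using Z z by simp
  qed
  have "cfun.independent (f ` Z)"
    unfolding cfun.dependent_finite[OF finite_imageI[OF Z]] using zero by blast
  then have "card (f ` Z) \<le> card C"
    using cfun.independent_span_bound[OF finC] f(1) C(3) by blast
  then have "card Z \<le> cfun.dim V" using card_image[OF inj] C(4) by simp
  then show ?thesis using True by (simp add: edim_def)
next
  case False
  then show ?thesis by (simp only: edim_def if_False) simp
qed

section \<open>Modular local polynomials for an invariant exceptional set\<close>

text \<open>These are the properties of \<open>E\<^sub>D\<close> on which the dimension count rests. The conditions on adjacent
  components guarantee that averages of polynomials given on the components make sense everywhere.\<close>

locale modular_partition =
  fixes E :: "complex set"
  assumes open_complement: "open (upper_half_plane - E)"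
    and SL2Z_act_notin: "\<gamma> \<in> SL2Z \<Longrightarrow> \<tau> \<in> upper_half_plane - E \<Longrightarrow> SL2Z_act \<gamma> \<tau> \<notin> E"
    and finite_adjacent: "\<tau> \<in> upper_half_plane \<Longrightarrow> finite (adjacent_components E \<tau>)"
    and adjacent_nonempty: "\<tau> \<in> upper_half_plane \<Longrightarrow> adjacent_components E \<tau> \<noteq> {}"
begin

abbreviation comps :: "complex set set" where
  "comps \<equiv> components (upper_half_plane - E)"

lemma comp_subset: "C \<in> comps \<Longrightarrow> C \<subseteq> upper_half_plane - E"
  by (rule in_components_subset)

lemma comp_in_H: "C \<in> comps \<Longrightarrow> z \<in> C \<Longrightarrow> z \<in> upper_half_plane"
  using comp_subset by blast

lemma comp_open: "C \<in> comps \<Longrightarrow> open C"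
  using open_components[OF open_complement] .

lemma comp_infinite: "C \<in> comps \<Longrightarrow> infinite C"
  using comp_open in_components_nonempty finite_imp_not_open by blast

lemma comp_eqI: "C \<in> comps \<Longrightarrow> C' \<in> comps \<Longrightarrow> z \<in> C \<Longrightarrow> z \<in> C' \<Longrightarrow> C = C'"
  using components_eq[of C _ C'] by blast

lemma ex_comp: "z \<in> upper_half_plane - E \<Longrightarrow> \<exists>C\<in>comps. z \<in> C"
  by (metis UnionE Union_components)

text \<open>The image of a component is connected and avoids \<open>E\<close>, so one common point decides.\<close>

lemma SL2Z_act_comp_subset:
  assumes C: "C \<in> comps" "x \<in> C" and C': "C' \<in> comps" "SL2Z_act \<gamma> x \<in> C'" and g: "\<gamma> \<in> SL2Z"
  shows "SL2Z_act \<gamma> ` C \<subseteq> C'"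
proof (rule components_maximal[OF C'(1)])
  show "connected (SL2Z_act \<gamma> ` C)"
    by (intro connected_continuous_image continuous_on_subset[OF continuous_on_SL2Z_act[OF g]]
        in_components_connected[OF C(1)]) (use comp_subset[OF C(1)] in auto)
  show "SL2Z_act \<gamma> ` C \<subseteq> upper_half_plane - E"
    using comp_subset[OF C(1)] SL2Z_act_notin[OF g] SL2Z_act_in_upper_half_plane[OF g] by blast
  show "C' \<inter> SL2Z_act \<gamma> ` C \<noteq> {}" using C C' by blast
qed

lemma SL2Z_act_comp:
  assumes C: "C \<in> comps" and g: "\<gamma> \<in> SL2Z"
  shows "SL2Z_act \<gamma> ` C \<in> comps"
proof -
  obtain \<delta> where d: "\<delta> \<in> SL2Z"
    "\<And>\<tau>. \<tau> \<in> upper_half_plane \<Longrightarrow> SL2Z_act \<delta> (SL2Z_act \<gamma> \<tau>) = \<tau>"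
    "\<And>\<tau>. \<tau> \<in> upper_half_plane \<Longrightarrow> SL2Z_act \<gamma> (SL2Z_act \<delta> \<tau>) = \<tau>"
    using SL2Z_inverse_both[OF g] by metis
  obtain x where x: "x \<in> C" using in_components_nonempty[OF C] by blast
  have xS: "x \<in> upper_half_plane - E" using x comp_subset[OF C] by blast
  then have "SL2Z_act \<gamma> x \<in> upper_half_plane - E"
    using SL2Z_act_notin[OF g] SL2Z_act_in_upper_half_plane[OF g] by blast
  then obtain C' where C': "C' \<in> comps" "SL2Z_act \<gamma> x \<in> C'" using ex_comp by blast
  have 1: "SL2Z_act \<gamma> ` C \<subseteq> C'" using SL2Z_act_comp_subset[OF C x C' g] .
  have "SL2Z_act \<delta> (SL2Z_act \<gamma> x) \<in> C" using d x xS by simp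
  then have 2: "SL2Z_act \<delta> ` C' \<subseteq> C" using SL2Z_act_comp_subset[OF C' C _ d(1)] by blast
  have "C' \<subseteq> SL2Z_act \<gamma> ` C"
  proof
    fix z assume z: "z \<in> C'"
    then have "z = SL2Z_act \<gamma> (SL2Z_act \<delta> z)" using d(3) comp_in_H[OF C'(1)] by simp
    then show "z \<in> SL2Z_act \<gamma> ` C" using 2 z by blast
  qed
  with 1 C' show ?thesis by (simp add: subset_antisym)
qed

lemma adjacent_iff: "C \<in> adjacent_components E \<tau> \<longleftrightarrow> C \<in> comps \<and> \<tau> \<in> closure C"
  by (simp add: adjacent_components_def closure_Un_frontier)

lemma adjacent_self:
  assumes C: "C \<in> comps" "\<tau> \<in> C"
  shows "adjacent_components E \<tau> = {C}"
proof -
  have "C' = C" if C': "C' \<in> comps" "\<tau> \<in> closure C'" for C'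
  proof -
    have "C \<inter> closure C' \<noteq> {}" using C(2) C'(2) by (intro notI) auto
    then have "C \<inter> C' \<noteq> {}" using open_Int_closure_eq_empty[OF comp_open[OF C(1)]] by metis
    then show ?thesis using components_eq[OF C(1) C'(1)] by metis
  qed
  moreover have "\<tau> \<in> closure C" using C(2) closure_subset by (rule rev_subsetD)
  ultimately show ?thesis using C(1) by (intro set_eqI) (metis adjacent_iff singleton_iff)
qed

lemma at_within_comp_nontrivial:
  assumes "C \<in> comps" "\<tau> \<in> closure C"
  shows "at \<tau> within C \<noteq> bot"
proof -
  have "\<tau> islimpt C"
  proof (cases "\<tau> \<in> C")
    case True
    then show ?thesis using comp_open[OF assms(1)] by (simp add: interior_limit_point interior_open)
  next
    case False
    then show ?thesis using assms(2) by (simp add: closure_def)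
  qed
  then show ?thesis by (simp add: trivial_limit_within)
qed

lemma tendsto_poly_on_comp:
  fixes p :: "complex poly"
  assumes "\<And>z. z \<in> C \<Longrightarrow> P z = poly p z"
  shows "(P \<longlongrightarrow> poly p \<tau>) (at \<tau> within C)"
proof -
  have "((\<lambda>z. poly p z) \<longlongrightarrow> poly p \<tau>) (at \<tau> within C)"
    by (rule tendsto_poly[OF tendsto_ident_at])
  moreover have "\<forall>\<^sub>F z in at \<tau> within C. poly p z = P z"
    using assms by (auto simp: eventually_at_filter)
  ultimately show ?thesis by (rule Lim_transform_eventually)
qed

lemma average_eq_poly_sum:
  assumes "\<tau> \<in> upper_half_plane" and p: "\<And>C z. C \<in> comps \<Longrightarrow> z \<in> C \<Longrightarrow> P z = poly (p C) z"
  shows "average E P \<tau> = 1 / of_nat (card (adjacent_components E \<tau>)) *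
      (\<Sum>C\<in>adjacent_components E \<tau>. poly (p C) \<tau>)"
    and "average_exists E P \<tau>"
proof -
  have lim: "(P \<longlongrightarrow> poly (p C) \<tau>) (at \<tau> within C)" if "C \<in> adjacent_components E \<tau>" for C
    using tendsto_poly_on_comp p that adjacent_iff by blast
  then show "average_exists E P \<tau>"
    using assms finite_adjacent adjacent_nonempty by (auto simp: average_exists_def)
  have "Lim (at \<tau> within C) P = poly (p C) \<tau>" if "C \<in> adjacent_components E \<tau>" for C
    using tendsto_Lim[OF _ lim] at_within_comp_nontrivial that adjacent_iff by blast
  then show "average E P \<tau> = 1 / of_nat (card (adjacent_components E \<tau>)) *
      (\<Sum>C\<in>adjacent_components E \<tau>. poly (p C) \<tau>)"
    unfolding average_def by simp
qed

lemma slash_eq: "slash (- int n) \<gamma> P \<tau> = automorphy \<gamma> \<tau> ^ n * P (SL2Z_act \<gamma> \<tau>)"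
  by (simp add: slash_def)

text \<open>Membership in terms of the polynomials on the components: the existence of the limits is
  then automatic, and the average becomes a finite sum.\<close>

lemma modular_local_polynomials_iff:
  "P \<in> modular_local_polynomials (- int n) E \<longleftrightarrow>
     (\<forall>\<tau>. \<tau> \<notin> upper_half_plane \<longrightarrow> P \<tau> = 0) \<and>
     (\<forall>\<gamma>\<in>SL2Z. \<forall>\<tau>\<in>upper_half_plane. automorphy \<gamma> \<tau> ^ n * P (SL2Z_act \<gamma> \<tau>) = P \<tau>) \<and>
     (\<exists>p. (\<forall>C\<in>comps. \<forall>z\<in>C. P z = poly (p C) z) \<and>
       (\<forall>\<tau>\<in>upper_half_plane. P \<tau> = 1 / of_nat (card (adjacent_components E \<tau>)) *
          (\<Sum>C\<in>adjacent_components E \<tau>. poly (p C) \<tau>)))"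
  (is "_ \<longleftrightarrow> ?Z P \<and> ?M P \<and> ?L P")
proof
  assume P: "P \<in> modular_local_polynomials (- int n) E"
  then have "\<forall>C\<in>comps. \<exists>p. \<forall>z\<in>C. P z = poly p z"
    by (auto simp: modular_local_polynomials_def local_polynomial_def)
  then obtain p where p: "\<And>C z. C \<in> comps \<Longrightarrow> z \<in> C \<Longrightarrow> P z = poly (p C) z" by metis
  have "P \<tau> = 1 / of_nat (card (adjacent_components E \<tau>)) *
      (\<Sum>C\<in>adjacent_components E \<tau>. poly (p C) \<tau>)" if "\<tau> \<in> upper_half_plane" for \<tau>
  proof -
    have "P \<tau> = average E P \<tau>"
      using P that unfolding modular_local_polynomials_def by blast
    also note average_eq_poly_sum(1)[OF that p]
    finally show ?thesis .
  qed
  then have "?L P" by (intro exI[of _ p] conjI ballI p)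
  moreover have "?Z P" "?M P" using P unfolding modular_local_polynomials_def slash_eq by blast+
  ultimately show "?Z P \<and> ?M P \<and> ?L P" by (intro conjI)
next
  assume P: "?Z P \<and> ?M P \<and> ?L P"
  then have "?L P" by (elim conjE)
  then obtain p where p: "\<And>C z. C \<in> comps \<Longrightarrow> z \<in> C \<Longrightarrow> P z = poly (p C) z"
    and av: "\<And>\<tau>. \<tau> \<in> upper_half_plane \<Longrightarrow> P \<tau> = 1 / of_nat (card (adjacent_components E \<tau>)) *
          (\<Sum>C\<in>adjacent_components E \<tau>. poly (p C) \<tau>)"
    by metis
  have loc: "local_polynomial E P" using p unfolding local_polynomial_def by blast
  have "average_exists E P \<tau> \<and> P \<tau> = average E P \<tau>" if "\<tau> \<in> upper_half_plane" for \<tau>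
    by (intro conjI average_eq_poly_sum(2)[OF that p]
        trans[OF av[OF that] average_eq_poly_sum(1)[OF that p, symmetric]])
  with loc P show "P \<in> modular_local_polynomials (- int n) E"
    unfolding modular_local_polynomials_def slash_eq by blast
qed

lemma modular_local_polynomialI:
  assumes "\<And>\<tau>. \<tau> \<notin> upper_half_plane \<Longrightarrow> P \<tau> = 0"
    and "\<And>\<gamma> \<tau>. \<gamma> \<in> SL2Z \<Longrightarrow> \<tau> \<in> upper_half_plane \<Longrightarrow>
      automorphy \<gamma> \<tau> ^ n * P (SL2Z_act \<gamma> \<tau>) = P \<tau>"
    and "\<And>C z. C \<in> comps \<Longrightarrow> z \<in> C \<Longrightarrow> P z = poly (p C) z"
    and "\<And>\<tau>. \<tau> \<in> upper_half_plane \<Longrightarrow> P \<tau> = 1 / of_nat (card (adjacent_components E \<tau>)) *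
          (\<Sum>C\<in>adjacent_components E \<tau>. poly (p C) \<tau>)"
  shows "P \<in> modular_local_polynomials (- int n) E"
  unfolding modular_local_polynomials_iff
  by (intro conjI exI[of _ p] ballI allI impI assms)

lemma modular_local_polynomialE:
  assumes "P \<in> modular_local_polynomials (- int n) E"
  obtains p where "\<And>\<tau>. \<tau> \<notin> upper_half_plane \<Longrightarrow> P \<tau> = 0"
    and "\<And>\<gamma> \<tau>. \<gamma> \<in> SL2Z \<Longrightarrow> \<tau> \<in> upper_half_plane \<Longrightarrow>
      automorphy \<gamma> \<tau> ^ n * P (SL2Z_act \<gamma> \<tau>) = P \<tau>"
    and "\<And>C z. C \<in> comps \<Longrightarrow> z \<in> C \<Longrightarrow> P z = poly (p C) z"
    and "\<And>\<tau>. \<tau> \<in> upper_half_plane \<Longrightarrow> P \<tau> = 1 / of_nat (card (adjacent_components E \<tau>)) *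
          (\<Sum>C\<in>adjacent_components E \<tau>. poly (p C) \<tau>)"
  using assms unfolding modular_local_polynomials_iff by metis

lemma subspace_modular_local_polynomials:
  "cfun.subspace (modular_local_polynomials (- int n) E)"
proof (rule cfun.subspaceI)
  show "0 \<in> modular_local_polynomials (- int n) E"
    by (rule modular_local_polynomialI[where p = "\<lambda>_. 0"]) simp_all
next
  fix P Q assume PQ: "P \<in> modular_local_polynomials (- int n) E" "Q \<in> modular_local_polynomials (- int n) E"
  obtain p where
    P: "\<And>\<tau>. \<tau> \<notin> upper_half_plane \<Longrightarrow> P \<tau> = 0"
      "\<And>\<gamma> \<tau>. \<gamma> \<in> SL2Z \<Longrightarrow> \<tau> \<in> upper_half_plane \<Longrightarrow>
        automorphy \<gamma> \<tau> ^ n * P (SL2Z_act \<gamma> \<tau>) = P \<tau>"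
      "\<And>C z. C \<in> comps \<Longrightarrow> z \<in> C \<Longrightarrow> P z = poly (p C) z"
      "\<And>\<tau>. \<tau> \<in> upper_half_plane \<Longrightarrow> P \<tau> = 1 / of_nat (card (adjacent_components E \<tau>)) *
          (\<Sum>C\<in>adjacent_components E \<tau>. poly (p C) \<tau>)"
    using modular_local_polynomialE[OF PQ(1)] by metis
  obtain q where
    Q: "\<And>\<tau>. \<tau> \<notin> upper_half_plane \<Longrightarrow> Q \<tau> = 0"
      "\<And>\<gamma> \<tau>. \<gamma> \<in> SL2Z \<Longrightarrow> \<tau> \<in> upper_half_plane \<Longrightarrow>
        automorphy \<gamma> \<tau> ^ n * Q (SL2Z_act \<gamma> \<tau>) = Q \<tau>"
      "\<And>C z. C \<in> comps \<Longrightarrow> z \<in> C \<Longrightarrow> Q z = poly (q C) z"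
      "\<And>\<tau>. \<tau> \<in> upper_half_plane \<Longrightarrow> Q \<tau> = 1 / of_nat (card (adjacent_components E \<tau>)) *
          (\<Sum>C\<in>adjacent_components E \<tau>. poly (q C) \<tau>)"
    using modular_local_polynomialE[OF PQ(2)] by metis
  show "P + Q \<in> modular_local_polynomials (- int n) E"
  proof (rule modular_local_polynomialI[where p = "\<lambda>C. p C + q C"])
    fix C z assume "C \<in> comps" "z \<in> C"
    then show "(P + Q) z = poly (p C + q C) z" using P(3)[of C z] Q(3)[of C z] by simp
  next
    fix \<tau> assume "\<tau> \<in> upper_half_plane"
    then show "(P + Q) \<tau> = 1 / of_nat (card (adjacent_components E \<tau>)) *
          (\<Sum>C\<in>adjacent_components E \<tau>. poly (p C + q C) \<tau>)"
      using P(4)[of \<tau>] Q(4)[of \<tau>] by (simp add: sum.distrib add_divide_distrib)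
  qed (simp_all add: P(1,2) Q(1,2) distrib_left)
next
  fix c P assume P0: "P \<in> modular_local_polynomials (- int n) E"
  obtain p where
    P: "\<And>\<tau>. \<tau> \<notin> upper_half_plane \<Longrightarrow> P \<tau> = 0"
      "\<And>\<gamma> \<tau>. \<gamma> \<in> SL2Z \<Longrightarrow> \<tau> \<in> upper_half_plane \<Longrightarrow>
        automorphy \<gamma> \<tau> ^ n * P (SL2Z_act \<gamma> \<tau>) = P \<tau>"
      "\<And>C z. C \<in> comps \<Longrightarrow> z \<in> C \<Longrightarrow> P z = poly (p C) z"
      "\<And>\<tau>. \<tau> \<in> upper_half_plane \<Longrightarrow> P \<tau> = 1 / of_nat (card (adjacent_components E \<tau>)) *
          (\<Sum>C\<in>adjacent_components E \<tau>. poly (p C) \<tau>)"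
    using modular_local_polynomialE[OF P0] by metis
  show "fun_scale c P \<in> modular_local_polynomials (- int n) E"
  proof (rule modular_local_polynomialI[where p = "\<lambda>C. smult c (p C)"])
    fix C z assume "C \<in> comps" "z \<in> C"
    then show "fun_scale c P z = poly (smult c (p C)) z" using P(3)[of C z] by (simp add: fun_scale_def)
  next
    fix \<tau> assume "\<tau> \<in> upper_half_plane"
    then show "fun_scale c P \<tau> = 1 / of_nat (card (adjacent_components E \<tau>)) *
          (\<Sum>C\<in>adjacent_components E \<tau>. poly (smult c (p C)) \<tau>)"
      using P(4)[of \<tau>] by (simp add: fun_scale_def sum_distrib_left)
  next
    fix \<gamma> \<tau> assume "\<gamma> \<in> SL2Z" "\<tau> \<in> upper_half_plane"
    from P(2)[OF this] show "automorphy \<gamma> \<tau> ^ n * fun_scale c P (SL2Z_act \<gamma> \<tau>) = fun_scale c P \<tau>"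
      by (simp add: fun_scale_def mult.left_commute)
  qed (simp add: P(1) fun_scale_def)
qed

lemma modular_local_polynomial_zero_iff:
  assumes P: "P \<in> modular_local_polynomials (- int n) E"
    and w: "w \<in> SL2Z_orbit \<tau>" and \<tau>: "\<tau> \<in> upper_half_plane"
  shows "P w = 0 \<longleftrightarrow> P \<tau> = 0"
proof -
  obtain \<gamma> where g: "\<gamma> \<in> SL2Z" "w = SL2Z_act \<gamma> \<tau>" using w by (rule SL2Z_orbitE)
  have "automorphy \<gamma> \<tau> ^ n * P w = P \<tau>"
    using modular_local_polynomialE[OF P] g \<tau> by metis
  then show ?thesis using automorphy_nonzero[OF g(1) \<tau>] by auto
qed

lemma modular_local_polynomial_eq_0:
  assumes P: "P \<in> modular_local_polynomials (- int n) E"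
    and z: "\<And>\<tau>. \<tau> \<in> upper_half_plane - E \<Longrightarrow> P \<tau> = 0"
  shows "P = 0"
proof
  fix \<tau>
  have zero: "P w = poly ((\<lambda>_. 0) C) w" if "C \<in> comps" "w \<in> C" for C w
    using z that comp_subset by auto
  show "P \<tau> = 0 \<tau>"
  proof (cases "\<tau> \<in> upper_half_plane")
    case True
    then have "P \<tau> = average E P \<tau>" using P unfolding modular_local_polynomials_def by blast
    also have "\<dots> = 0" using average_eq_poly_sum(1)[OF True zero] by simp
    finally show ?thesis by simp
  next
    case False
    then show ?thesis using P by (simp add: modular_local_polynomials_def)
  qed
qed

text \<open>Equivariance under \<open>\<tau> \<mapsto> -1/\<tau>\<close> makes \<open>\<tau>\<^sup>n q(-1/\<tau>)\<close>, for another polynomial \<open>q\<close>, equal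
  to the polynomial on a component; clearing denominators bounds the degree by \<open>n\<close>.\<close>

lemma modular_local_polynomial_on_comp:
  assumes P: "P \<in> modular_local_polynomials (- int n) E" and C: "C \<in> comps"
  shows "\<exists>p. degree p \<le> n \<and> (\<forall>z\<in>C. P z = poly p z)"
proof -
  define S where "S = mat2 0 (-1) 1 0"
  have S: "S \<in> SL2Z" by (simp add: S_def mat2_in_SL2Z)
  obtain pp where pp: "\<And>C z. C \<in> comps \<Longrightarrow> z \<in> C \<Longrightarrow> P z = poly (pp C) z"
    using modular_local_polynomialE[OF P] by metis
  define p q where "p = pp C" and "q = pcompose (pp (SL2Z_act S ` C)) [:0, -1:]"
  define d where "d = degree q"
  have eq: "poly (monom 1 d * p) z = poly (monom 1 n * reflect_poly q) z" if z: "z \<in> C" for z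
  proof -
    have zH: "z \<in> upper_half_plane" using comp_in_H[OF C z] .
    then have z0: "z \<noteq> 0" by (auto simp: upper_half_plane_def)
    have "P z = automorphy S z ^ n * P (SL2Z_act S z)"
      using modular_local_polynomialE[OF P] S zH by metis
    also have "\<dots> = z ^ n * P (- 1 / z)" by (simp add: S_def automorphy_mat2 SL2Z_act_mat2)
    also have "P (- 1 / z) = poly (pp (SL2Z_act S ` C)) (- 1 / z)"
      using z by (intro pp SL2Z_act_comp[OF C S]) (auto simp: S_def SL2Z_act_mat2)
    also have "\<dots> = poly q (inverse z)" by (simp add: q_def poly_pcompose field_simps)
    finally have "poly p z = z ^ n * poly q (inverse z)" using pp[OF C z] by (simp add: p_def)
    then show ?thesis using z0 by (simp add: poly_monom poly_reflect_poly_nz d_def)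
  qed
  have peq: "monom 1 d * p = monom 1 n * reflect_poly q"
  proof (rule ccontr)
    assume "\<not> ?thesis"
    then have "finite {x. poly (monom 1 d * p - monom 1 n * reflect_poly q) x = 0}"
      by (intro poly_roots_finite) simp
    moreover have "C \<subseteq> {x. poly (monom 1 d * p - monom 1 n * reflect_poly q) x = 0}"
      using eq by auto
    ultimately show False using comp_infinite[OF C] finite_subset by blast
  qed
  have "degree p \<le> n"
  proof (cases "p = 0")
    case False
    have "degree (monom 1 d * p) = d + degree p"
      using False by (simp add: degree_mult_eq monom_eq_0_iff degree_monom_eq)
    moreover have "degree (monom 1 n * reflect_poly q) \<le> n + d"
      using degree_mult_le[of "monom 1 n" "reflect_poly q"] degree_reflect_poly_le[of q]
        degree_monom_le[of "1::complex" n] by (simp add: d_def)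
    ultimately show ?thesis using peq by simp
  qed simp
  then show ?thesis using pp[OF C] by (intro exI[of _ p]) (simp add: p_def)
qed

lemma modular_local_polynomial_vanishes_on_comp:
  assumes P: "P \<in> modular_local_polynomials (- int n) E" and C: "C \<in> comps"
    and A: "A \<subseteq> C" "card A = n + 1" and zero: "\<And>z. z \<in> A \<Longrightarrow> P z = 0" and z: "z \<in> C"
  shows "P z = 0"
proof -
  obtain p where p: "degree p \<le> n" "\<And>z. z \<in> C \<Longrightarrow> P z = poly p z"
    using modular_local_polynomial_on_comp[OF P C] by metis
  have "p = 0"
  proof (rule poly_eqI_degree[of A])
    show "poly p x = poly 0 x" if "x \<in> A" for x using p(2)[of x] zero[OF that] that A by auto
    show "degree p < card A" "degree 0 < card A" using p A by auto
  qed
  then show ?thesis using p(2)[OF z] by simp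
qed

section \<open>Covering families of components\<close>

definition covering :: "complex set set \<Rightarrow> bool" where
  "covering R \<longleftrightarrow> R \<subseteq> comps \<and> (\<forall>\<tau>\<in>upper_half_plane - E. \<exists>w\<in>\<Union>R. w \<in> SL2Z_orbit \<tau>)"

lemma covering_of_fundamental_domain:
  assumes F: "fundamental_domain F"
  shows "covering {C \<in> comps. C \<inter> F \<noteq> {}}"
  unfolding covering_def
proof (intro conjI ballI)
  fix \<tau> assume \<tau>: "\<tau> \<in> upper_half_plane - E"
  then obtain w where w: "w \<in> F" "w \<in> SL2Z_orbit \<tau>" using F unfolding fundamental_domain_def by blast
  then obtain \<gamma> where g: "\<gamma> \<in> SL2Z" "w = SL2Z_act \<gamma> \<tau>" using SL2Z_orbitE by metis
  then have "w \<in> upper_half_plane - E" using SL2Z_act_notin SL2Z_act_in_upper_half_plane \<tau> by blast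
  then show "\<exists>w\<in>\<Union>{C \<in> comps. C \<inter> F \<noteq> {}}. w \<in> SL2Z_orbit \<tau>" using ex_comp w by blast
qed auto

text \<open>A fundamental domain may be chosen orbit by orbit, so each orbit off \<open>E\<close> can be represented
  inside the given family.\<close>

lemma fundamental_domain_of_covering:
  assumes R: "covering R"
  obtains F where "fundamental_domain F" "{C \<in> comps. C \<inter> F \<noteq> {}} \<subseteq> R"
proof -
  define r where "r O' = (SOME w. w \<in> O' \<and> (O' \<inter> \<Union>R \<noteq> {} \<longrightarrow> w \<in> \<Union>R))" for O' :: "complex set"
  define F where "F = (\<lambda>\<tau>. r (SL2Z_orbit \<tau>)) ` upper_half_plane"
  have r: "r (SL2Z_orbit \<tau>) \<in> SL2Z_orbit \<tau> \<and> (SL2Z_orbit \<tau> \<inter> \<Union>R \<noteq> {} \<longrightarrow> r (SL2Z_orbit \<tau>) \<in> \<Union>R)" for \<tau>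
  proof -
    have "\<exists>w. w \<in> SL2Z_orbit \<tau> \<and> (SL2Z_orbit \<tau> \<inter> \<Union>R \<noteq> {} \<longrightarrow> w \<in> \<Union>R)"
      using SL2Z_orbit_refl[of \<tau>] by blast
    from someI_ex[OF this] show ?thesis unfolding r_def by blast
  qed
  have "fundamental_domain F"
    unfolding fundamental_domain_def
  proof (intro conjI ballI)
    show "F \<subseteq> upper_half_plane"
      using r SL2Z_orbit_subset_upper_half_plane unfolding F_def by blast
    fix \<tau> assume t: "\<tau> \<in> upper_half_plane"
    show "\<exists>!w. w \<in> F \<inter> SL2Z_orbit \<tau>"
    proof (rule ex1I[of _ "r (SL2Z_orbit \<tau>)"])
      show "r (SL2Z_orbit \<tau>) \<in> F \<inter> SL2Z_orbit \<tau>" using r t unfolding F_def by blast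
    next
      fix w assume "w \<in> F \<inter> SL2Z_orbit \<tau>"
      then obtain s where s: "s \<in> upper_half_plane" "w = r (SL2Z_orbit s)" "w \<in> SL2Z_orbit \<tau>"
        unfolding F_def by blast
      have "SL2Z_orbit s = SL2Z_orbit w" using s r SL2Z_orbit_eq by metis
      also have "\<dots> = SL2Z_orbit \<tau>" using SL2Z_orbit_eq[OF s(3) t] .
      finally show "w = r (SL2Z_orbit \<tau>)" using s(2) by simp
    qed
  qed
  moreover have "C \<in> R" if C: "C \<in> comps" "w \<in> C" "w \<in> F" for C w
  proof -
    obtain s where s: "s \<in> upper_half_plane" "w = r (SL2Z_orbit s)" using C(3) unfolding F_def by blast
    have "w \<in> SL2Z_orbit s" using s r by blast
    then have "SL2Z_orbit s = SL2Z_orbit w" using SL2Z_orbit_eq s(1) by blast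
    moreover have "SL2Z_orbit w \<inter> \<Union>R \<noteq> {}" using R C comp_subset[OF C(1)] unfolding covering_def by blast
    ultimately have "w \<in> \<Union>R" using r s(2) by metis
    then obtain C' where "C' \<in> R" "w \<in> C'" by blast
    then show ?thesis using comp_eqI[OF C(1) _ C(2)] R unfolding covering_def by blast
  qed
  ultimately show ?thesis using that[of F] by blast
qed

text \<open>The interpolation nodes \<open>A C\<close> determine the polynomial on each component \<open>C\<close> of the family,
  hence the values on all orbits off \<open>E\<close>. The evaluation points \<open>Z\<close> need only represent the nodes up to
  equivalence; that freedom is what makes the strict inequality below possible.\<close>

lemma edim_le_covering:
  assumes R: "covering R" "finite R"
    and A: "\<And>C. C \<in> R \<Longrightarrow> A C \<subseteq> C" "\<And>C. C \<in> R \<Longrightarrow> card (A C) = n + 1"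
    and Z: "finite Z" "\<And>C z. C \<in> R \<Longrightarrow> z \<in> A C \<Longrightarrow> \<exists>w\<in>Z. w \<in> SL2Z_orbit z"
  shows "edim (modular_local_polynomials (- int n) E) \<le> enat (card Z)"
proof (rule edim_le_card[OF subspace_modular_local_polynomials Z(1)])
  fix P assume P: "P \<in> modular_local_polynomials (- int n) E" and zero: "\<forall>z\<in>Z. P z = 0"
  have 1: "P z = 0" if CR: "C \<in> R" and zC: "z \<in> C" for C z
  proof (rule modular_local_polynomial_vanishes_on_comp[OF P _ A(1,2)[OF CR] _ zC])
    show C: "C \<in> comps" using R CR unfolding covering_def by blast
    fix x assume x: "x \<in> A C"
    then have xH: "x \<in> upper_half_plane" using A(1)[OF CR] comp_in_H[OF C] by blast
    obtain w where "w \<in> Z" "w \<in> SL2Z_orbit x" using Z(2) CR x by blast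
    then show "P x = 0" using modular_local_polynomial_zero_iff[OF P _ xH] zero by blast
  qed
  show "P = 0"
  proof (rule modular_local_polynomial_eq_0[OF P])
    fix \<tau> assume t: "\<tau> \<in> upper_half_plane - E"
    then obtain w where w: "w \<in> \<Union>R" "w \<in> SL2Z_orbit \<tau>" using R unfolding covering_def by blast
    then have "P w = 0" using 1 by blast
    then show "P \<tau> = 0" using modular_local_polynomial_zero_iff[OF P w(2)] t by blast
  qed
qed

lemma ex_nodes_in_comp:
  assumes C: "C \<in> comps" and B: "B \<subseteq> C" "finite B" "card B \<le> m"
  shows "\<exists>A. B \<subseteq> A \<and> A \<subseteq> C \<and> finite A \<and> card A = m"
proof -
  have "infinite (C - B)" using comp_infinite[OF C] B by simp
  then obtain A where A: "A \<subseteq> C - B" "finite A" "card A = m - card B"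
    using infinite_arbitrarily_large by blast
  have "card (B \<union> A) = m" using A B by (subst card_Un_disjoint) auto
  then show ?thesis using A B by (intro exI[of _ "B \<union> A"]) auto
qed

lemma edim_le:
  assumes R: "covering R" "finite R"
  shows "edim (modular_local_polynomials (- int n) E) \<le> enat ((n + 1) * card R)"
proof -
  have "\<forall>C\<in>R. \<exists>A. A \<subseteq> C \<and> finite A \<and> card A = n + 1"
    using R ex_nodes_in_comp[of _ "{}" "n + 1"] unfolding covering_def by auto
  then obtain A where A: "\<And>C. C \<in> R \<Longrightarrow> A C \<subseteq> C \<and> finite (A C) \<and> card (A C) = n + 1" by metis
  have "edim (modular_local_polynomials (- int n) E) \<le> enat (card (\<Union>(A ` R)))"
  proof (rule edim_le_covering[OF R, of A])
    show "\<exists>w\<in>\<Union>(A ` R). w \<in> SL2Z_orbit z" if "C \<in> R" "z \<in> A C" for C z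
      using that SL2Z_orbit_refl by blast
  qed (use A R in auto)
  also have "card (\<Union>(A ` R)) \<le> (\<Sum>C\<in>R. card (A C))" using R by (intro card_UN_le)
  also have "\<dots> = (n + 1) * card R" using A by simp
  finally show ?thesis by simp
qed

text \<open>Two equivalent points of one component impose only one condition, so it pays to choose both
  among the interpolation nodes of that component.\<close>

lemma edim_less:
  assumes R: "covering R" "finite R" and n: "n \<ge> 1"
    and C: "C \<in> comps" "z \<in> C" "w \<in> C" "w \<in> SL2Z_orbit z" "w \<noteq> z"
  shows "edim (modular_local_polynomials (- int n) E) < enat ((n + 1) * card R)"
proof -
  obtain \<gamma> where g: "\<gamma> \<in> SL2Z" "w = SL2Z_act \<gamma> z" using C(4) by (rule SL2Z_orbitE)
  have zH: "z \<in> upper_half_plane" and wH: "w \<in> upper_half_plane" and zE: "z \<in> upper_half_plane - E"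
    using C comp_subset by blast+
  \<comment> \<open>Move the two points into a component of the family.\<close>
  obtain z' where z': "z' \<in> \<Union>R" "z' \<in> SL2Z_orbit z" using R zE unfolding covering_def by blast
  then obtain C' where C': "C' \<in> R" "z' \<in> C'" by blast
  have C'c: "C' \<in> comps" using C' R unfolding covering_def by blast
  obtain \<delta> where d: "\<delta> \<in> SL2Z" "z' = SL2Z_act \<delta> z" using z'(2) by (rule SL2Z_orbitE)
  define w' where "w' = SL2Z_act \<delta> w"
  have w'C: "w' \<in> C'"
    using SL2Z_act_comp_subset[OF C(1,2) C'c _ d(1)] C'(2) C(3) d(2) unfolding w'_def by blast
  have w'z': "w' \<noteq> z'" using SL2Z_act_inj[OF d(1) wH zH] C(5) d(2) unfolding w'_def by blast
  have "w' \<in> SL2Z_orbit w" unfolding w'_def by (rule mem_SL2Z_orbit[OF d(1)])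
  then have "SL2Z_orbit w' = SL2Z_orbit z'"
    using SL2Z_orbit_eq zH wH C(4) z'(2) by metis
  then have orb: "z' \<in> SL2Z_orbit w'" using SL2Z_orbit_refl by blast
  have "\<exists>A. A \<subseteq> C'' \<and> finite A \<and> card A = n + 1 \<and> (C'' = C' \<longrightarrow> z' \<in> A \<and> w' \<in> A)" if "C'' \<in> R" for C''
  proof (cases "C'' = C'")
    case True
    then show ?thesis using ex_nodes_in_comp[OF C'c, of "{z', w'}" "n + 1"] C' w'C n w'z' by auto
  next
    case False
    then show ?thesis using R that ex_nodes_in_comp[of C'' "{}" "n + 1"] unfolding covering_def by auto
  qed
  then obtain A where A: "\<And>C''. C'' \<in> R \<Longrightarrow> A C'' \<subseteq> C'' \<and> finite (A C'') \<and> card (A C'') = n + 1"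
    and A': "z' \<in> A C'" "w' \<in> A C'" using C' by metis
  define Z where "Z = \<Union>(A ` R) - {w'}"
  have finU: "finite (\<Union>(A ` R))" using A R by auto
  have "\<exists>x\<in>Z. x \<in> SL2Z_orbit y" if "C'' \<in> R" "y \<in> A C''" for C'' y
  proof (cases "y = w'")
    case True
    then show ?thesis using orb A' C' w'z' unfolding Z_def by blast
  next
    case False
    then show ?thesis using that SL2Z_orbit_refl unfolding Z_def by blast
  qed
  then have "edim (modular_local_polynomials (- int n) E) \<le> enat (card Z)"
    using A R finU by (intro edim_le_covering[of R A]) (auto simp: Z_def)
  moreover have "card Z < card (\<Union>(A ` R))"
    unfolding Z_def using finU A' C' by (intro psubset_card_mono) auto
  moreover have "card (\<Union>(A ` R)) \<le> (\<Sum>C\<in>R. card (A C))" using R by (intro card_UN_le)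
  moreover have "(\<Sum>C\<in>R. card (A C)) = (n + 1) * card R" using A by simp
  ultimately show ?thesis by (metis enat_ord_simps(2) order.strict_trans1 order.strict_trans2)
qed

end

section \<open>Extending a polynomial from one component\<close>

text \<open>The polynomial \<open>(c\<tau> + d)\<^sup>n q((a\<tau> + b) / (c\<tau> + d))\<close>: it is homogenised to degree \<open>n\<close>, so that
  for \<open>degree q \<le> n\<close> no denominators remain.\<close>

definition slash_poly :: "nat \<Rightarrow> int ^ 2 ^ 2 \<Rightarrow> complex poly \<Rightarrow> complex poly" where
  "slash_poly n \<gamma> q = (\<Sum>i\<le>n. smult (coeff q i)
     ([:of_int (\<gamma> $ 1 $ 2), of_int (\<gamma> $ 1 $ 1):] ^ i * [:of_int (\<gamma> $ 2 $ 2), of_int (\<gamma> $ 2 $ 1):] ^ (n - i)))"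

lemma poly_slash_poly:
  assumes "degree q \<le> n" and nz: "automorphy \<gamma> \<tau> \<noteq> 0"
  shows "poly (slash_poly n \<gamma> q) \<tau> = automorphy \<gamma> \<tau> ^ n * poly q (SL2Z_act \<gamma> \<tau>)"
proof -
  define N where "N = of_int (\<gamma> $ 1 $ 1) * \<tau> + of_int (\<gamma> $ 1 $ 2)"
  have act: "SL2Z_act \<gamma> \<tau> = N / automorphy \<gamma> \<tau>" by (simp add: SL2Z_act_def N_def)
  have "poly q x = (\<Sum>i\<le>n. coeff q i * x ^ i)" for x
    unfolding poly_altdef using assms
    by (intro sum.mono_neutral_left) (auto simp: coeff_eq_0)
  then have "automorphy \<gamma> \<tau> ^ n * poly q (SL2Z_act \<gamma> \<tau>)
      = (\<Sum>i\<le>n. automorphy \<gamma> \<tau> ^ n * (coeff q i * (N / automorphy \<gamma> \<tau>) ^ i))"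
    by (simp add: act sum_distrib_left)
  also have "\<dots> = (\<Sum>i\<le>n. coeff q i * (N ^ i * automorphy \<gamma> \<tau> ^ (n - i)))"
  proof (intro sum.cong refl)
    fix i assume "i \<in> {..n}"
    then have "automorphy \<gamma> \<tau> ^ n = automorphy \<gamma> \<tau> ^ i * automorphy \<gamma> \<tau> ^ (n - i)"
      by (simp flip: power_add)
    then show "automorphy \<gamma> \<tau> ^ n * (coeff q i * (N / automorphy \<gamma> \<tau>) ^ i)
        = coeff q i * (N ^ i * automorphy \<gamma> \<tau> ^ (n - i))"
      using nz by (simp add: power_divide)
  qed
  also have "\<dots> = poly (slash_poly n \<gamma> q) \<tau>"
    by (simp add: slash_poly_def poly_sum poly_power N_def automorphy_def algebra_simps)
  finally show ?thesis by simp
qed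

context modular_partition
begin

lemma SL2Z_act_closure:
  assumes \<tau>: "\<tau> \<in> upper_half_plane" "\<tau> \<in> closure C" and g: "\<gamma> \<in> SL2Z"
  shows "SL2Z_act \<gamma> \<tau> \<in> closure (SL2Z_act \<gamma> ` C)"
proof -
  obtain x where x: "\<And>i. x i \<in> C" "x \<longlonglongrightarrow> \<tau>" using \<tau>(2) unfolding closure_sequential by blast
  have "(\<lambda>i. SL2Z_act \<gamma> (x i)) \<longlonglongrightarrow> SL2Z_act \<gamma> \<tau>"
    using isCont_tendsto_compose[OF isCont_SL2Z_act[OF g \<tau>(1)] x(2)] .
  then show ?thesis unfolding closure_sequential using x(1)
    by (intro exI[of _ "\<lambda>i. SL2Z_act \<gamma> (x i)"]) auto
qed

lemma bij_betw_adjacent: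
  assumes \<tau>: "\<tau> \<in> upper_half_plane" and g: "\<gamma> \<in> SL2Z"
  shows "bij_betw ((`) (SL2Z_act \<gamma>)) (adjacent_components E \<tau>) (adjacent_components E (SL2Z_act \<gamma> \<tau>))"
proof -
  obtain \<delta> where d: "\<delta> \<in> SL2Z"
    "\<And>\<tau>. \<tau> \<in> upper_half_plane \<Longrightarrow> SL2Z_act \<delta> (SL2Z_act \<gamma> \<tau>) = \<tau>"
    "\<And>\<tau>. \<tau> \<in> upper_half_plane \<Longrightarrow> SL2Z_act \<gamma> (SL2Z_act \<delta> \<tau>) = \<tau>"
    using SL2Z_inverse_both[OF g] by metis
  have gt: "SL2Z_act \<gamma> \<tau> \<in> upper_half_plane" using SL2Z_act_in_upper_half_plane[OF g \<tau>] .
  have 1: "SL2Z_act \<delta> ` SL2Z_act \<gamma> ` C = C" "SL2Z_act \<gamma> ` SL2Z_act \<delta> ` C = C" if "C \<in> comps" for C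
    using d comp_in_H[OF that] by (auto simp: image_image)
  show ?thesis
  proof (rule bij_betwI[where g = "(`) (SL2Z_act \<delta>)"])
    show "(`) (SL2Z_act \<gamma>) \<in> adjacent_components E \<tau> \<rightarrow> adjacent_components E (SL2Z_act \<gamma> \<tau>)"
      using SL2Z_act_comp SL2Z_act_closure[OF \<tau>] g by (auto simp: adjacent_iff)
    show "(`) (SL2Z_act \<delta>) \<in> adjacent_components E (SL2Z_act \<gamma> \<tau>) \<rightarrow> adjacent_components E \<tau>"
      using SL2Z_act_comp[OF _ d(1)] SL2Z_act_closure[OF gt _ d(1)] d(2)[OF \<tau>] by (auto simp: adjacent_iff)
  qed (auto simp: adjacent_iff 1)
qed

lemma ex_point_notin:
  assumes "C \<in> comps" "finite B"
  obtains z where "z \<in> C" "z \<notin> B"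
  using comp_infinite[OF assms(1)] assms(2) by (meson finite_subset subsetI)

text \<open>Equivariance dictates the values on all translates of \<open>C0\<close>. By \<open>sep\<close>, two matrices that
  move the same point into \<open>C0\<close> agree on its whole component, so their factors have
  equal squares and, \<open>n\<close> being even, equal \<open>n\<close>-th powers; this makes the values well defined. On the
  other components the value is zero, and on \<open>E\<close> it is the average.\<close>

lemma modular_extension:
  assumes n: "even n" and C0: "C0 \<in> comps" and q: "degree q \<le> n"
    and sep: "\<And>z w. z \<in> C0 \<Longrightarrow> w \<in> C0 \<Longrightarrow> w \<in> SL2Z_orbit z \<Longrightarrow> w = z"
  shows "\<exists>P\<in>modular_local_polynomials (- int n) E. (\<forall>z\<in>C0. P z = poly q z) \<and>
    (\<forall>z\<in>upper_half_plane - E. SL2Z_orbit z \<inter> C0 = {} \<longrightarrow> P z = 0)"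
proof -
  define P0 where "P0 \<tau> = (if SL2Z_orbit \<tau> \<inter> C0 = {} then 0 else
     (let \<gamma> = (SOME \<gamma>. \<gamma> \<in> SL2Z \<and> SL2Z_act \<gamma> \<tau> \<in> C0) in automorphy \<gamma> \<tau> ^ n * poly q (SL2Z_act \<gamma> \<tau>)))" for \<tau>
  have P0_zero: "P0 \<tau> = 0" if "SL2Z_orbit \<tau> \<inter> C0 = {}" for \<tau> using that by (simp add: P0_def)
  \<comment> \<open>The value does not depend on the choice of the matrix.\<close>
  have key: "P0 \<tau> = automorphy \<gamma> \<tau> ^ n * poly q (SL2Z_act \<gamma> \<tau>)"
    if \<tau>: "\<tau> \<in> upper_half_plane - E" and g: "\<gamma> \<in> SL2Z" "SL2Z_act \<gamma> \<tau> \<in> C0" for \<tau> \<gamma>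
  proof -
    define \<delta> where "\<delta> = (SOME \<gamma>. \<gamma> \<in> SL2Z \<and> SL2Z_act \<gamma> \<tau> \<in> C0)"
    have d: "\<delta> \<in> SL2Z" "SL2Z_act \<delta> \<tau> \<in> C0"
      using someI[of "\<lambda>\<gamma>. \<gamma> \<in> SL2Z \<and> SL2Z_act \<gamma> \<tau> \<in> C0" \<gamma>] g unfolding \<delta>_def by auto
    have "SL2Z_orbit \<tau> \<inter> C0 \<noteq> {}" using g mem_SL2Z_orbit by blast
    then have P0: "P0 \<tau> = automorphy \<delta> \<tau> ^ n * poly q (SL2Z_act \<delta> \<tau>)"
      by (simp add: P0_def \<delta>_def Let_def)
    obtain C where C: "C \<in> comps" "\<tau> \<in> C" using ex_comp[OF \<tau>] by blast
    have eq: "SL2Z_act \<gamma> z = SL2Z_act \<delta> z" if z: "z \<in> C" for z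
    proof (rule sep)
      show "SL2Z_act \<delta> z \<in> C0" "SL2Z_act \<gamma> z \<in> C0"
        using SL2Z_act_comp_subset[OF C C0 g(2,1)] SL2Z_act_comp_subset[OF C C0 d(2,1)] z by blast+
      have zH: "z \<in> upper_half_plane" using comp_in_H[OF C(1) z] .
      have "SL2Z_orbit (SL2Z_act \<delta> z) = SL2Z_orbit z"
        using SL2Z_orbit_eq[OF mem_SL2Z_orbit[OF d(1)] zH] .
      then show "SL2Z_act \<gamma> z \<in> SL2Z_orbit (SL2Z_act \<delta> z)" using mem_SL2Z_orbit[OF g(1)] by simp
    qed
    obtain y where y: "y \<in> C" "y \<notin> {\<tau>}" by (rule ex_point_notin[OF C(1), of "{\<tau>}"]) simp
    obtain z where z: "z \<in> C" "z \<notin> {\<tau>, y}" by (rule ex_point_notin[OF C(1), of "{\<tau>, y}"]) simp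
    have "(automorphy \<gamma> \<tau>)\<^sup>2 = (automorphy \<delta> \<tau>)\<^sup>2"
      using y(2) z(2) by (intro automorphy_square_eq[OF g(1) d(1), of \<tau> y z] eq comp_in_H[OF C(1)]
          y(1) z(1) C(2)) auto
    then have "automorphy \<gamma> \<tau> ^ n = automorphy \<delta> \<tau> ^ n"
      using n by (metis dvd_def power_mult)
    then show ?thesis using P0 eq[OF C(2)] by simp
  qed
  have equiv: "automorphy \<gamma> \<tau> ^ n * P0 (SL2Z_act \<gamma> \<tau>) = P0 \<tau>"
    if \<tau>: "\<tau> \<in> upper_half_plane - E" and g: "\<gamma> \<in> SL2Z" for \<tau> \<gamma>
  proof -
    have tH: "\<tau> \<in> upper_half_plane" using \<tau> by blast
    have gt: "SL2Z_act \<gamma> \<tau> \<in> upper_half_plane - E"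
      using \<tau> g SL2Z_act_notin SL2Z_act_in_upper_half_plane by blast
    have orb: "SL2Z_orbit (SL2Z_act \<gamma> \<tau>) = SL2Z_orbit \<tau>"
      using SL2Z_orbit_eq[OF mem_SL2Z_orbit[OF g] tH] .
    show ?thesis
    proof (cases "SL2Z_orbit \<tau> \<inter> C0 = {}")
      case True
      then show ?thesis using P0_zero orb by simp
    next
      case False
      then obtain w where w: "w \<in> SL2Z_orbit (SL2Z_act \<gamma> \<tau>)" "w \<in> C0" using orb by blast
      then obtain \<delta> where d: "\<delta> \<in> SL2Z" "SL2Z_act \<delta> (SL2Z_act \<gamma> \<tau>) \<in> C0" using SL2Z_orbitE by metis
      have m: "SL2Z_act (\<delta> ** \<gamma>) \<tau> = SL2Z_act \<delta> (SL2Z_act \<gamma> \<tau>)" using SL2Z_act_mult[OF d(1) g tH] .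
      have "P0 \<tau> = automorphy (\<delta> ** \<gamma>) \<tau> ^ n * poly q (SL2Z_act (\<delta> ** \<gamma>) \<tau>)"
        using key[OF \<tau> SL2Z_mult[OF d(1) g]] d(2) m by simp
      then show ?thesis using key[OF gt d] m
        by (simp add: automorphy_mult[OF g tH] power_mult_distrib)
    qed
  qed
  have "\<forall>C\<in>comps. \<exists>p. \<forall>z\<in>C. P0 z = poly p z"
  proof
    fix C assume C: "C \<in> comps"
    show "\<exists>p. \<forall>z\<in>C. P0 z = poly p z"
    proof (cases "\<exists>z\<in>C. SL2Z_orbit z \<inter> C0 \<noteq> {}")
      case True
      then obtain x w where x: "x \<in> C" "w \<in> SL2Z_orbit x" "w \<in> C0" by blast
      then obtain \<gamma> where g: "\<gamma> \<in> SL2Z" "SL2Z_act \<gamma> x \<in> C0" using SL2Z_orbitE by metis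
      have "P0 z = poly (slash_poly n \<gamma> q) z" if z: "z \<in> C" for z
      proof -
        have zS: "z \<in> upper_half_plane - E" using z comp_subset[OF C] by blast
        have "SL2Z_act \<gamma> z \<in> C0" using SL2Z_act_comp_subset[OF C x(1) C0 g(2,1)] z by blast
        then show ?thesis
          using key[OF zS g(1)] poly_slash_poly[OF q] automorphy_nonzero[OF g(1)] zS by simp
      qed
      then show ?thesis by blast
    next
      case False
      then show ?thesis using P0_zero by (intro exI[of _ 0]) auto
    qed
  qed
  then obtain p where p: "\<And>C z. C \<in> comps \<Longrightarrow> z \<in> C \<Longrightarrow> P0 z = poly (p C) z" by metis
  define P where "P \<tau> = (if \<tau> \<in> upper_half_plane then 1 / of_nat (card (adjacent_components E \<tau>)) *
      (\<Sum>C\<in>adjacent_components E \<tau>. poly (p C) \<tau>) else 0)" for \<tau>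
  have PP0: "P z = P0 z" if "C \<in> comps" "z \<in> C" for C z
  proof -
    have "P z = poly (p C) z" using comp_in_H[OF that] by (simp add: P_def adjacent_self[OF that])
    then show ?thesis using p[OF that] by simp
  qed
  \<comment> \<open>Equivariance passes from a component to its closure by continuity.\<close>
  have p_equiv: "automorphy \<gamma> \<tau> ^ n * poly (p (SL2Z_act \<gamma> ` C)) (SL2Z_act \<gamma> \<tau>) = poly (p C) \<tau>"
    if \<tau>: "\<tau> \<in> upper_half_plane" and C: "C \<in> comps" "\<tau> \<in> closure C" and g: "\<gamma> \<in> SL2Z" for \<tau> C \<gamma>
  proof -
    let ?f = "\<lambda>z. automorphy \<gamma> z ^ n * poly (p (SL2Z_act \<gamma> ` C)) (SL2Z_act \<gamma> z)"
    have act: "(SL2Z_act \<gamma> \<longlongrightarrow> SL2Z_act \<gamma> \<tau>) (at \<tau> within C)"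
      using continuous_within_subset[OF isCont_SL2Z_act[OF g \<tau>] subset_UNIV] unfolding continuous_within .
    have "(?f \<longlongrightarrow> ?f \<tau>) (at \<tau> within C)"
      unfolding automorphy_def by (intro tendsto_intros act)
    moreover have "\<forall>\<^sub>F z in at \<tau> within C. ?f z = P0 z"
      unfolding eventually_at_filter
    proof (intro always_eventually allI impI)
      fix z assume z: "z \<in> C"
      have "P0 (SL2Z_act \<gamma> z) = poly (p (SL2Z_act \<gamma> ` C)) (SL2Z_act \<gamma> z)"
        by (rule p[OF SL2Z_act_comp[OF C(1) g]]) (use z in blast)
      then show "?f z = P0 z" using equiv[OF _ g, of z] comp_subset[OF C(1)] z by auto
    qed
    ultimately have "(P0 \<longlongrightarrow> ?f \<tau>) (at \<tau> within C)" by (rule Lim_transform_eventually)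
    moreover have "(P0 \<longlongrightarrow> poly (p C) \<tau>) (at \<tau> within C)"
      by (rule tendsto_poly_on_comp[OF p[OF C(1)]])
    ultimately show ?thesis using tendsto_unique at_within_comp_nontrivial[OF C] by blast
  qed
  have "P \<in> modular_local_polynomials (- int n) E"
  proof (rule modular_local_polynomialI[where p = p])
    fix \<gamma> \<tau> assume g: "\<gamma> \<in> SL2Z" and \<tau>: "\<tau> \<in> upper_half_plane"
    have bij: "bij_betw ((`) (SL2Z_act \<gamma>)) (adjacent_components E \<tau>) (adjacent_components E (SL2Z_act \<gamma> \<tau>))"
      using bij_betw_adjacent[OF \<tau> g] .
    have "automorphy \<gamma> \<tau> ^ n * (\<Sum>C\<in>adjacent_components E (SL2Z_act \<gamma> \<tau>). poly (p C) (SL2Z_act \<gamma> \<tau>))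
       = (\<Sum>C\<in>adjacent_components E \<tau>. automorphy \<gamma> \<tau> ^ n * poly (p (SL2Z_act \<gamma> ` C)) (SL2Z_act \<gamma> \<tau>))"
      unfolding sum_distrib_left by (rule sum.reindex_bij_betw[OF bij, symmetric])
    also have "\<dots> = (\<Sum>C\<in>adjacent_components E \<tau>. poly (p C) \<tau>)"
      by (intro sum.cong refl p_equiv[OF \<tau> _ _ g]) (auto simp: adjacent_iff)
    finally show "automorphy \<gamma> \<tau> ^ n * P (SL2Z_act \<gamma> \<tau>) = P \<tau>"
      using \<tau> SL2Z_act_in_upper_half_plane[OF g \<tau>] bij_betw_same_card[OF bij] by (simp add: P_def)
  next
    fix C z assume "C \<in> comps" "z \<in> C"
    with PP0[of C z] p[of C z] show "P z = poly (p C) z" by simp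
  qed (simp_all add: P_def)
  moreover have "P z = poly q z" if z: "z \<in> C0" for z
  proof -
    have "SL2Z_act (mat 1) z = z" "automorphy (mat 1) z = 1"
      by (simp_all add: SL2Z_act_def automorphy_def mat_def)
    moreover have "mat 1 \<in> SL2Z" by (simp add: SL2Z_def)
    moreover have "z \<in> upper_half_plane - E" using z comp_subset[OF C0] by blast
    ultimately have "P0 z = 1 ^ n * poly q z" using key[of z "mat 1"] z by metis
    then show ?thesis using PP0[OF C0 z] by simp
  qed
  moreover have "P z = 0" if zS: "z \<in> upper_half_plane - E" and orb: "SL2Z_orbit z \<inter> C0 = {}" for z
  proof -
    obtain C where "C \<in> comps" "z \<in> C" using ex_comp[OF zS] by blast
    from PP0[OF this] show ?thesis using P0_zero[OF orb] by simp
  qed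
  ultimately show ?thesis by blast
qed

lemma edim_ge:
  assumes n: "even n" and R: "R \<subseteq> comps" "finite R"
    and sep: "\<And>z w. z \<in> \<Union>R \<Longrightarrow> w \<in> \<Union>R \<Longrightarrow> w \<in> SL2Z_orbit z \<Longrightarrow> w = z"
  shows "enat ((n + 1) * card R) \<le> edim (modular_local_polynomials (- int n) E)"
proof -
  have "\<forall>C\<in>R. \<exists>A. A \<subseteq> C \<and> finite A \<and> card A = n + 1"
    using R ex_nodes_in_comp[of _ "{}" "n + 1"] by auto
  then obtain A where A: "\<And>C. C \<in> R \<Longrightarrow> A C \<subseteq> C \<and> finite (A C) \<and> card (A C) = n + 1" by metis
  define Z where "Z = \<Union>(A ` R)"
  have disj: "C \<inter> C' = {}" if "C \<in> R" "C' \<in> R" "C \<noteq> C'" for C C'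
    using components_nonoverlap[of C _ C'] that R by blast
  have "card Z = (\<Sum>C\<in>R. card (A C))"
    unfolding Z_def using R A disj by (intro card_UN_disjoint) blast+
  also have "\<dots> = (n + 1) * card R" using A by simp
  finally have card: "card Z = (n + 1) * card R" .
  have finZ: "finite Z" using A R unfolding Z_def by auto
  have "enat (card Z) \<le> edim (modular_local_polynomials (- int n) E)"
  proof (rule card_le_edim[OF finZ])
    fix z assume "z \<in> Z"
    then obtain C where C: "C \<in> R" "z \<in> A C" unfolding Z_def by blast
    have Cc: "C \<in> comps" using R C by blast
    \<comment> \<open>The Lagrange basis polynomial of \<open>z\<close> among the nodes of its component.\<close>
    define q where "q = (\<Prod>x\<in>A C - {z}. smult (1 / (z - x)) [:- x, 1:])"
    have finA: "finite (A C)" and cardA: "card (A C) = n + 1" using A C by auto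
    have "degree q \<le> (\<Sum>x\<in>A C - {z}. degree (smult (1 / (z - x)) [:- x, 1:]))"
      unfolding q_def by (rule degree_prod_sum_le[unfolded comp_def]) (use finA in simp)
    also have "\<dots> \<le> (\<Sum>x\<in>A C - {z}. 1)" by (intro sum_mono order_trans[OF degree_smult_le]) simp
    also have "\<dots> = n" using finA cardA C by simp
    finally have deg: "degree q \<le> n" .
    have qz: "poly q z = 1" 
      unfolding q_def poly_prod
    proof (rule prod.neutral, rule ballI)
      fix x assume "x \<in> A C - {z}"
      then have "z - x \<noteq> 0" by auto
      moreover have "poly (smult (1 / (z - x)) [:- x, 1:]) z = 1 / (z - x) * (z - x)"
        by (simp only: poly_smult poly_pCons poly_0) simp
      ultimately show "poly (smult (1 / (z - x)) [:- x, 1:]) z = 1" by simp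
    qed
    have qx: "poly q x = 0" if "x \<in> A C" "x \<noteq> z" for x
      unfolding q_def poly_prod using that finA by (intro prod_zero) (auto intro!: bexI[of _ x])
    obtain P where P: "P \<in> modular_local_polynomials (- int n) E" "\<And>z. z \<in> C \<Longrightarrow> P z = poly q z"
      "\<And>z. z \<in> upper_half_plane - E \<Longrightarrow> SL2Z_orbit z \<inter> C = {} \<Longrightarrow> P z = 0"
      using modular_extension[OF n Cc deg] sep C by blast
    have "P x = (if x = z then 1 else 0)" if x: "x \<in> Z" for x
    proof -
      obtain C' where C': "C' \<in> R" "x \<in> A C'" using x unfolding Z_def by blast
      show ?thesis
      proof (cases "C' = C")
        case True
        then have "x \<in> C" using C' A by blast
        then show ?thesis using P(2)[of x] qz qx C' True by auto
      next
        case False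
        have xC: "x \<in> C'" "x \<notin> C" using C' A disj[OF C'(1) C(1) False] by blast+
        have "SL2Z_orbit x \<inter> C = {}" using sep[of x] xC C C' by blast
        then have "P x = 0" using P(3)[of x] xC comp_subset[of C'] C' R by blast
        moreover have "z \<in> C" using C A by blast
        ultimately show ?thesis using xC by auto
      qed
    qed
    then show "\<exists>f\<in>modular_local_polynomials (- int n) E. \<forall>x\<in>Z. f x = (if x = z then 1 else 0)"
      using P(1) by blast
  qed
  then show ?thesis using card by simp
qed

section \<open>The dimension and fundamental domains\<close>

definition comps_meeting :: "complex set \<Rightarrow> complex set set" where
  "comps_meeting F = {C \<in> comps. C \<inter> F \<noteq> {}}"

lemma edim_le_comps_meeting:
  assumes F: "fundamental_domain F"
  shows "edim (modular_local_polynomials (- int n) E) \<le> enat (n + 1) * ecard (comps_meeting F)"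
proof (cases "finite (comps_meeting F)")
  case True
  then show ?thesis
    using edim_le[OF covering_of_fundamental_domain[OF F]] by (simp add: comps_meeting_def ecard_def)
next
  case False
  then show ?thesis by (simp add: ecard_def imult_is_infinity zero_enat_def)
qed

lemma INF_comps_meeting:
  assumes R0: "covering R0" "finite R0"
  obtains R where "covering R" "finite R" "\<And>R'. covering R' \<Longrightarrow> finite R' \<Longrightarrow> card R \<le> card R'"
    "(INF F\<in>{F. fundamental_domain F}. ecard (comps_meeting F)) = enat (card R)"
proof -
  define R where "R = (ARG_MIN card R. covering R \<and> finite R)"
  have "covering R \<and> finite R"
    unfolding R_def by (rule arg_min_natI[where k = R0]) (simp add: R0)
  then have R: "covering R" "finite R" by simp_all
  have min: "card R \<le> card R'" if "covering R'" "finite R'" for R'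
    unfolding R_def by (rule arg_min_nat_le) (simp add: that)
  have "(INF F\<in>{F. fundamental_domain F}. ecard (comps_meeting F)) = enat (card R)"
  proof (rule antisym)
    obtain F where F: "fundamental_domain F" "comps_meeting F \<subseteq> R"
      unfolding comps_meeting_def by (rule fundamental_domain_of_covering[OF R(1)])
    have "ecard (comps_meeting F) \<le> enat (card R)"
      using card_mono[OF R(2) F(2)] finite_subset[OF F(2) R(2)] by (simp add: ecard_def)
    then show "(INF F\<in>{F. fundamental_domain F}. ecard (comps_meeting F)) \<le> enat (card R)"
      using F(1) by (intro INF_lower2[of F]) auto
    show "enat (card R) \<le> (INF F\<in>{F. fundamental_domain F}. ecard (comps_meeting F))"
    proof (rule INF_greatest)
      fix F assume "F \<in> {F. fundamental_domain F}"
      then have "covering (comps_meeting F)"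
        using covering_of_fundamental_domain by (simp add: comps_meeting_def)
      then show "enat (card R) \<le> ecard (comps_meeting F)"
        using min by (simp add: ecard_def)
    qed
  qed
  with R min show ?thesis by (rule that)
qed

text \<open>Of two components that a matrix maps onto each other, one could be left out of a covering
  family.\<close>

lemma minimal_covering_inequivalent:
  assumes R: "covering R" "finite R" and min: "\<And>R'. covering R' \<Longrightarrow> finite R' \<Longrightarrow> card R \<le> card R'"
    and C: "C \<in> R" "z \<in> C" and C': "C' \<in> R" "w \<in> C'" and w: "w \<in> SL2Z_orbit z"
  shows "C = C'"
proof (rule ccontr)
  assume ne: "C \<noteq> C'"
  have comps: "C \<in> comps" "C' \<in> comps" using R C C' unfolding covering_def by blast+
  have zH: "z \<in> upper_half_plane" using comp_in_H[OF comps(1) C(2)] .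
  have "z \<in> SL2Z_orbit w" using SL2Z_orbit_sym[OF w zH] .
  then obtain \<gamma> where g: "\<gamma> \<in> SL2Z" "SL2Z_act \<gamma> w = z" using SL2Z_orbitE by metis
  have "covering (R - {C'})"
    unfolding covering_def
  proof (intro conjI ballI)
    show "R - {C'} \<subseteq> comps" using R unfolding covering_def by blast
    fix \<tau> assume t: "\<tau> \<in> upper_half_plane - E"
    then obtain x C'' where x: "C'' \<in> R" "x \<in> C''" "x \<in> SL2Z_orbit \<tau>" using R unfolding covering_def by blast
    show "\<exists>w\<in>\<Union>(R - {C'}). w \<in> SL2Z_orbit \<tau>"
    proof (cases "C'' = C'")
      case False
      then show ?thesis using x by blast
    next
      case True
      have "SL2Z_act \<gamma> x \<in> C"
        using SL2Z_act_comp_subset[OF comps(2) C'(2) comps(1) _ g(1)] g(2) C(2) x(2) True by blast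
      moreover have "SL2Z_act \<gamma> x \<in> SL2Z_orbit \<tau>"
        using mem_SL2Z_orbit[OF g(1), of x] SL2Z_orbit_eq[OF x(3)] t by blast
      ultimately show ?thesis using C ne by blast
    qed
  qed
  then have "card R \<le> card (R - {C'})" using min R by simp
  moreover have "card (R - {C'}) < card R" using R C' by (intro psubset_card_mono) auto
  ultimately show False by simp
qed

theorem edim_eq_iff:
  assumes n: "even n" "n \<ge> 1" and R0: "covering R0" "finite R0"
  shows "edim (modular_local_polynomials (- int n) E)
        = enat (n + 1) * (INF F\<in>{F. fundamental_domain F}. ecard (comps_meeting F)) \<longleftrightarrow>
      (\<forall>C\<in>comps. \<forall>z\<in>C. \<forall>w\<in>C. w \<in> SL2Z_orbit z \<longrightarrow> w = z)"
proof -
  obtain R where R: "covering R" "finite R" and min: "\<And>R'. covering R' \<Longrightarrow> finite R' \<Longrightarrow> card R \<le> card R'"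
    and INF: "(INF F\<in>{F. fundamental_domain F}. ecard (comps_meeting F)) = enat (card R)"
    using INF_comps_meeting[OF R0] by blast
  show ?thesis
  proof
    assume eq: "edim (modular_local_polynomials (- int n) E)
        = enat (n + 1) * (INF F\<in>{F. fundamental_domain F}. ecard (comps_meeting F))"
    show "\<forall>C\<in>comps. \<forall>z\<in>C. \<forall>w\<in>C. w \<in> SL2Z_orbit z \<longrightarrow> w = z"
      using edim_less[OF R n(2)] eq INF by auto
  next
    assume sep: "\<forall>C\<in>comps. \<forall>z\<in>C. \<forall>w\<in>C. w \<in> SL2Z_orbit z \<longrightarrow> w = z"
    have Rc: "R \<subseteq> comps" using R unfolding covering_def by blast
    have "w = z" if zw: "z \<in> \<Union>R" "w \<in> \<Union>R" "w \<in> SL2Z_orbit z" for z w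
    proof -
      obtain C C' where C: "C \<in> R" "z \<in> C" "C' \<in> R" "w \<in> C'" using zw by blast
      then have "C = C'" using minimal_covering_inequivalent[OF R min] zw(3) by blast
      then show ?thesis using sep C zw(3) Rc by blast
    qed
    then have "enat ((n + 1) * card R) \<le> edim (modular_local_polynomials (- int n) E)"
      by (intro edim_ge[OF n(1) Rc R(2)])
    with edim_le[OF R, of n] show "edim (modular_local_polynomials (- int n) E)
        = enat (n + 1) * (INF F\<in>{F. fundamental_domain F}. ecard (comps_meeting F))"
      unfolding INF by simp
  qed
qed

end

section \<open>The geodesics of a positive discriminant\<close>

definition form_value :: "int \<times> int \<times> int \<Rightarrow> complex \<Rightarrow> real" where
  "form_value = (\<lambda>(a, b, c) \<tau>. of_int a * (cmod \<tau>)\<^sup>2 + of_int b * Re \<tau> + of_int c)"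

lemma mem_exceptional_set:
  "\<tau> \<in> exceptional_set D \<longleftrightarrow> \<tau> \<in> upper_half_plane \<and> (\<exists>Q\<in>quadratic_forms D. form_value Q \<tau> = 0)"
proof -
  have "geodesic Q = {\<tau> \<in> upper_half_plane. form_value Q \<tau> = 0}" for Q
    by (cases Q) (simp add: geodesic_def form_value_def)
  then show ?thesis by (auto simp: exceptional_set_def)
qed

text \<open>Completing the square. For \<open>a \<noteq> 0\<close> this is the half circle with centre \<open>-b/2a\<close> and radius
  \<open>\<surd>D / 2\<bar>a\<bar>\<close>.\<close>

lemma form_value_discriminant:
  assumes "(a, b, c) \<in> quadratic_forms D" "form_value (a, b, c) z = 0"
  shows "(2 * of_int a * Re z + of_int b)\<^sup>2 + 4 * (of_int a)\<^sup>2 * (Im z)\<^sup>2 = of_int D"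
proof -
  have "of_int D = (of_int b)\<^sup>2 - 4 * of_int a * (of_int c :: real)"
    using assms(1) by (auto simp: quadratic_forms_def)
  moreover have "of_int c = - of_int a * ((Re z)\<^sup>2 + (Im z)\<^sup>2) - of_int b * Re z"
    using assms(2) by (simp add: form_value_def cmod_power2)
  ultimately show ?thesis by (simp add: power2_eq_square algebra_simps)
qed

definition half_strip :: "real \<Rightarrow> real \<Rightarrow> complex set" where
  "half_strip X Y = {z. \<bar>Re z\<bar> \<le> X \<and> Im z \<ge> Y}"

text \<open>The height of the half circles bounds \<open>a\<close>, their position then bounds \<open>b\<close>, and \<open>c\<close> follows from the
  discriminant, or, for the vertical lines \<open>a = 0\<close>, from their position.\<close>

lemma finite_forms_vanishing_on_half_strip:
  assumes D: "D > 0" and Y: "Y > 0"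
  shows "finite {Q \<in> quadratic_forms D. \<exists>z\<in>half_strip X Y. form_value Q z = 0}"
proof -
  define M1 where "M1 = \<lceil>of_int D / (4 * Y\<^sup>2)\<rceil>"
  define M2 where "M2 = D + 2 * M1 * \<lceil>X\<rceil>"
  define M3 where "M3 = M2 * M2 + D + M2 * \<lceil>X\<rceil>"
  have "a \<in> {-M1..M1} \<and> b \<in> {-M2..M2} \<and> c \<in> {-M3..M3}"
    if Q: "(a, b, c) \<in> quadratic_forms D" and z: "z \<in> half_strip X Y" "form_value (a, b, c) z = 0" for a b c z
  proof -
    have zX: "\<bar>Re z\<bar> \<le> X" and zY: "Im z \<ge> Y" using z by (auto simp: half_strip_def)
    have X0: "\<bar>Re z\<bar> \<le> of_int \<lceil>X\<rceil>" using zX by linarith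
    then have X1: "\<lceil>X\<rceil> \<ge> 0" by linarith
    note disc = form_value_discriminant[OF Q z(2)]
    have Y2: "Y\<^sup>2 \<le> (Im z)\<^sup>2" using zY Y by (intro power_mono) auto
    have "4 * (of_int a)\<^sup>2 * Y\<^sup>2 \<le> 4 * (of_int a)\<^sup>2 * (Im z)\<^sup>2" using Y2 by (intro mult_left_mono) auto
    also have "\<dots> \<le> of_int D"
      using disc zero_le_power2[of "2 * of_int a * Re z + of_int b"] by linarith
    finally have "(of_int a)\<^sup>2 * (4 * Y\<^sup>2) \<le> of_int D" by (simp add: mult_ac)
    then have "(of_int a)\<^sup>2 \<le> of_int D / (4 * Y\<^sup>2)" using Y by (simp add: pos_le_divide_eq)
    also have "\<dots> \<le> of_int M1" unfolding M1_def by simp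
    finally have "of_int (a\<^sup>2) \<le> (of_int M1 :: real)" by simp
    then have a2: "a\<^sup>2 \<le> M1" using of_int_le_iff by blast
    have "\<bar>a\<bar> \<le> a\<^sup>2"
    proof (cases "a = 0")
      case False
      then have "\<bar>a\<bar> * 1 \<le> \<bar>a\<bar> * \<bar>a\<bar>" by (intro mult_left_mono) auto
      then show ?thesis by (simp add: power2_eq_square)
    qed simp
    with a2 have aM: "\<bar>a\<bar> \<le> M1" by linarith
    have D2: "(of_int D :: real) \<le> (of_int D)\<^sup>2" using D by (simp add: power2_eq_square)
    have "0 \<le> 4 * (of_int a)\<^sup>2 * (Im z)\<^sup>2" by simp
    then have "(2 * of_int a * Re z + of_int b)\<^sup>2 \<le> of_int D" using disc by linarith
    also note D2
    finally have "\<bar>2 * of_int a * Re z + of_int b\<bar> \<le> of_int D"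
      using D by (simp add: abs_le_square_iff[symmetric])
    moreover have "\<bar>2 * of_int a * Re z\<bar> \<le> 2 * of_int M1 * of_int \<lceil>X\<rceil>"
      using aM X0 X1 unfolding abs_mult by (intro mult_mono) auto
    ultimately have "\<bar>of_int b\<bar> \<le> (of_int M2 :: real)" unfolding M2_def by simp
    then have bM: "\<bar>b\<bar> \<le> M2" by linarith
    have M2: "M2 \<ge> 0" using bM by linarith
    have "\<bar>c\<bar> \<le> M3"
    proof (cases "a = 0")
      case True
      then have "\<bar>of_int c\<bar> = \<bar>of_int b\<bar> * \<bar>Re z\<bar>" using z(2) by (simp add: form_value_def flip: abs_mult)
      also have "\<dots> \<le> of_int M2 * of_int \<lceil>X\<rceil>" using bM X0 M2 by (intro mult_mono) auto
      finally have "of_int \<bar>c\<bar> \<le> (of_int (M2 * \<lceil>X\<rceil>) :: real)" by simp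
      then have "\<bar>c\<bar> \<le> M2 * \<lceil>X\<rceil>" using of_int_le_iff by blast
      moreover have "M2 * M2 \<ge> 0" by simp
      ultimately show ?thesis using D unfolding M3_def by linarith
    next
      case False
      have "4 * (a * c) = b\<^sup>2 - D" using Q by (auto simp: quadratic_forms_def)
      then have "\<bar>a * c\<bar> \<le> b\<^sup>2 + D" using D zero_le_power2[of b] by linarith
      moreover have "1 * \<bar>c\<bar> \<le> \<bar>a\<bar> * \<bar>c\<bar>" using False by (intro mult_right_mono) auto
      moreover have "\<bar>b\<bar> * \<bar>b\<bar> \<le> M2 * M2" using bM M2 by (intro mult_mono) auto
      moreover have "M2 * \<lceil>X\<rceil> \<ge> 0" using M2 X1 by simp
      ultimately show ?thesis unfolding M3_def by (simp add: abs_mult power2_eq_square)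
    qed
    with aM bM show ?thesis by auto
  qed
  then have "{Q \<in> quadratic_forms D. \<exists>z\<in>half_strip X Y. form_value Q z = 0}
      \<subseteq> {-M1..M1} \<times> {-M2..M2} \<times> {-M3..M3}" by auto
  then show ?thesis by (rule finite_subset) auto
qed

text \<open>The coordinates \<open>(Re z, \<bar>z\<bar>\<^sup>2)\<close> are those of the Klein model: the geodesics become straight lines,
  and the values of a quadratic form are affine along the straight segment from \<open>z\<close> to \<open>w\<close>.\<close>

lemma klein_segment:
  assumes z: "Im z \<ge> Y" and w: "Im w \<ge> Y" and Y: "Y > 0"
  obtains T where "connected T" "z \<in> T" "w \<in> T"
    "\<And>p. p \<in> T \<Longrightarrow> Im p \<ge> Y \<and> (\<exists>t\<in>{0..1}. Re p = (1 - t) * Re z + t * Re w \<and>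
      (\<forall>Q. form_value Q p = (1 - t) * form_value Q z + t * form_value Q w))"
proof -
  define u where "u t = (1 - t) * Re z + t * Re w" for t
  define v where "v t = (1 - t) * (cmod z)\<^sup>2 + t * (cmod w)\<^sup>2" for t
  define g where "g t = Complex (u t) (sqrt (v t - (u t)\<^sup>2))" for t
  have vu: "v t - (u t)\<^sup>2 = (1 - t) * (Im z)\<^sup>2 + t * (Im w)\<^sup>2 + t * (1 - t) * (Re z - Re w)\<^sup>2" for t
    unfolding v_def u_def cmod_power2 by (simp add: power2_eq_square algebra_simps)
  have Y2: "Y\<^sup>2 \<le> v t - (u t)\<^sup>2" if t: "t \<in> {0..1}" for t
  proof -
    have "(1 - t) * Y\<^sup>2 \<le> (1 - t) * (Im z)\<^sup>2" "t * Y\<^sup>2 \<le> t * (Im w)\<^sup>2"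
      using z w Y t by (auto intro!: mult_left_mono power_mono)
    moreover have "0 \<le> t * (1 - t) * (Re z - Re w)\<^sup>2" using t by simp
    moreover have "(1 - t) * Y\<^sup>2 + t * Y\<^sup>2 = Y\<^sup>2" by (simp add: algebra_simps)
    ultimately show ?thesis unfolding vu by linarith
  qed
  have "continuous_on {0..1} g"
    unfolding g_def u_def v_def Complex_eq by (intro continuous_intros)
  then have "connected (g ` {0..1})" using connected_Icc by (rule connected_continuous_image)
  moreover have "z \<in> g ` {0..1}"
  proof
    show "z = g 0" using z Y by (simp add: g_def u_def v_def cmod_power2 complex_eq_iff)
  qed simp
  moreover have "w \<in> g ` {0..1}"
  proof
    show "w = g 1" using w Y by (simp add: g_def u_def v_def cmod_power2 complex_eq_iff)
  qed simp
  moreover have "Im p \<ge> Y \<and> (\<exists>t\<in>{0..1}. Re p = (1 - t) * Re z + t * Re w \<and>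
      (\<forall>Q. form_value Q p = (1 - t) * form_value Q z + t * form_value Q w))" if "p \<in> g ` {0..1}" for p
  proof -
    obtain t where t: "t \<in> {0..1}" "p = g t" using \<open>p \<in> g ` {0..1}\<close> by blast
    have Imp: "Im p \<ge> Y" using Y2[OF t(1)] Y t(2) by (simp add: g_def real_le_rsqrt)
    have "0 \<le> v t - (u t)\<^sup>2" using Y2[OF t(1)] zero_le_power2[of Y] by linarith
    then have cp: "(cmod p)\<^sup>2 = v t" using t(2) by (simp add: g_def cmod_power2)
    have rp: "Re p = u t" using t(2) by (simp add: g_def)
    have val: "form_value Q p = (1 - t) * form_value Q z + t * form_value Q w" for Q
      by (cases Q) (simp add: form_value_def cp rp, simp add: u_def v_def algebra_simps)
    have "Re p = (1 - t) * Re z + t * Re w" by (simp add: rp u_def)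
    then show ?thesis by (intro conjI Imp bexI[OF _ t(1)] allI val)
  qed
  ultimately show ?thesis by (rule that)
qed

text \<open>A component that meets the half strip is determined by the signs there of the finitely many forms
  that vanish somewhere on it.\<close>

lemma finite_components_meeting_half_strip:
  assumes D: "D > 0" and Y: "Y > 0"
  shows "finite {C \<in> components (upper_half_plane - exceptional_set D). C \<inter> half_strip X Y \<noteq> {}}"
proof -
  define QQ where "QQ = {Q \<in> quadratic_forms D. \<exists>z\<in>half_strip X Y. form_value Q z = 0}"
  define CC where "CC = {C \<in> components (upper_half_plane - exceptional_set D). C \<inter> half_strip X Y \<noteq> {}}"
  have fin: "finite QQ" unfolding QQ_def by (rule finite_forms_vanishing_on_half_strip[OF D Y])
  define pt where "pt C = (SOME z. z \<in> C \<inter> half_strip X Y)" for C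
  have pt: "pt C \<in> C \<inter> half_strip X Y" if "C \<in> CC" for C
    using that some_in_eq[of "C \<inter> half_strip X Y"] unfolding pt_def CC_def by blast
  define sg where "sg C = {Q \<in> QQ. form_value Q (pt C) > 0}" for C
  have inj: "inj_on sg CC"
  proof (rule inj_onI)
    fix C C' assume C: "C \<in> CC" and C': "C' \<in> CC" and eq: "sg C = sg C'"
    have Cc: "C \<in> components (upper_half_plane - exceptional_set D)"
      "C' \<in> components (upper_half_plane - exceptional_set D)" using C C' by (auto simp: CC_def)
    have strip: "pt C \<in> half_strip X Y" "pt C' \<in> half_strip X Y" using pt C C' by auto
    obtain T where T: "connected T" "pt C \<in> T" "pt C' \<in> T" and
      seg: "\<And>p. p \<in> T \<Longrightarrow> Im p \<ge> Y \<and> (\<exists>t\<in>{0..1}. Re p = (1 - t) * Re (pt C) + t * Re (pt C') \<and>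
        (\<forall>Q. form_value Q p = (1 - t) * form_value Q (pt C) + t * form_value Q (pt C')))"
      by (rule klein_segment[of Y "pt C" "pt C'"]) (use strip Y in \<open>auto simp: half_strip_def\<close>)
    have nz: "form_value Q (pt B) \<noteq> 0" if "Q \<in> QQ" "B \<in> CC" for Q B
    proof -
      have "pt B \<in> upper_half_plane - exceptional_set D"
        using pt[OF that(2)] that(2) in_components_subset unfolding CC_def by blast
      then show ?thesis using that(1) unfolding mem_exceptional_set Diff_iff QQ_def by blast
    qed
    have "T \<subseteq> upper_half_plane - exceptional_set D"
    proof
      fix p assume p: "p \<in> T"
      obtain t where t: "t \<in> {0..1}" "Re p = (1 - t) * Re (pt C) + t * Re (pt C')" and
        val: "\<And>Q. form_value Q p = (1 - t) * form_value Q (pt C) + t * form_value Q (pt C')"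
        and Im: "Im p \<ge> Y"
        using seg[OF p] by blast
      have "\<bar>Re p\<bar> \<le> (1 - t) * \<bar>Re (pt C)\<bar> + t * \<bar>Re (pt C')\<bar>"
        using t abs_triangle_ineq[of "(1 - t) * Re (pt C)" "t * Re (pt C')"] by (simp add: abs_mult)
      also have "\<dots> \<le> X" using strip t(1) by (intro convex_bound_le) (auto simp: half_strip_def)
      finally have strip_p: "p \<in> half_strip X Y" using Im by (simp add: half_strip_def)
      have "form_value Q p \<noteq> 0" if Q: "Q \<in> quadratic_forms D" for Q
      proof (cases "Q \<in> QQ")
        case False
        then show ?thesis using strip_p Q unfolding QQ_def by blast
      next
        case True
        have t01: "0 \<le> t" "t \<le> 1" using t(1) by auto
        show ?thesis
        proof (cases "form_value Q (pt C) > 0")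
          case pos: True
          then have "form_value Q (pt C') > 0" using eq True unfolding sg_def by blast
          with pos have "(1 - t) * (- form_value Q (pt C)) + t * (- form_value Q (pt C')) < 0"
            using t01 by (intro convex_bound_lt) auto
          then show ?thesis using val[of Q] by (simp add: algebra_simps)
        next
          case neg: False
          then have "\<not> form_value Q (pt C') > 0" using eq True unfolding sg_def by blast
          then have "form_value Q (pt C') < 0" "form_value Q (pt C) < 0"
            using neg nz[OF True C] nz[OF True C'] by linarith+
          then have "(1 - t) * form_value Q (pt C) + t * form_value Q (pt C') < 0"
            using t01 by (intro convex_bound_lt) auto
          then show ?thesis using val[of Q] by simp
        qed
      qed
      then show "p \<in> upper_half_plane - exceptional_set D"
        using Im Y by (auto simp: mem_exceptional_set upper_half_plane_def)
    qed
    then have "T \<subseteq> C" "T \<subseteq> C'"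
      using components_maximal[OF Cc(1) T(1)] components_maximal[OF Cc(2) T(1)] T(2,3) pt[OF C] pt[OF C']
      by (meson IntD1 disjoint_iff)+
    then show "C = C'" using components_eq[OF Cc] T by blast
  qed
  have "sg ` CC \<subseteq> Pow QQ" by (auto simp: sg_def)
  then have "finite (sg ` CC)" by (rule finite_subset) (simp add: fin)
  then show ?thesis using inj unfolding CC_def[symmetric] by (rule finite_imageD)
qed

definition open_half_strip :: "real \<Rightarrow> real \<Rightarrow> complex set" where
  "open_half_strip X Y = {z. \<bar>Re z\<bar> < X \<and> Im z > Y}"

lemma open_open_half_strip: "open (open_half_strip X Y)"
  unfolding open_half_strip_def by (intro open_Collect_conj open_Collect_less continuous_intros)

lemma open_half_strip_subset: "open_half_strip X Y \<subseteq> half_strip X Y"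
  by (auto simp: open_half_strip_def half_strip_def)

lemma mem_open_half_strip_self:
  "z \<in> upper_half_plane \<Longrightarrow> z \<in> open_half_strip (\<bar>Re z\<bar> + 1) (Im z / 2)"
  by (simp add: open_half_strip_def upper_half_plane_def)

lemma continuous_form_value: "continuous_on S (form_value Q)"
  unfolding form_value_def by (cases Q) (simp, intro continuous_intros)

lemma open_complement_exceptional_set:
  assumes D: "D > 0"
  shows "open (upper_half_plane - exceptional_set D)"
proof (subst open_subopen, intro ballI)
  fix z assume z: "z \<in> upper_half_plane - exceptional_set D"
  define X Y where "X = \<bar>Re z\<bar> + 1" and "Y = Im z / 2"
  have Y: "Y > 0" using z by (simp add: Y_def upper_half_plane_def)
  define QQ where "QQ = {Q \<in> quadratic_forms D. \<exists>z\<in>half_strip X Y. form_value Q z = 0}"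
  have fin: "finite QQ" unfolding QQ_def by (rule finite_forms_vanishing_on_half_strip[OF D Y])
  define U where "U = open_half_strip X Y \<inter> (\<Inter>Q\<in>QQ. {w. form_value Q w \<noteq> 0})"
  have "open {w. form_value Q w \<noteq> 0}" for Q
    by (rule open_Collect_neq[OF continuous_form_value continuous_on_const])
  then have "open U" unfolding U_def by (intro open_Int open_open_half_strip open_INT fin ballI)
  moreover have "z \<in> U"
  proof -
    have "z \<in> open_half_strip X Y" using z mem_open_half_strip_self[of z] by (simp add: X_def Y_def)
    moreover have "form_value Q z \<noteq> 0" if "Q \<in> QQ" for Q
      using z that unfolding Diff_iff mem_exceptional_set QQ_def by blast
    ultimately show ?thesis unfolding U_def by blast
  qed
  moreover have "U \<subseteq> upper_half_plane - exceptional_set D"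
  proof
    fix w assume w: "w \<in> U"
    then have "w \<in> half_strip X Y" using open_half_strip_subset unfolding U_def by blast
    then have "form_value Q w \<noteq> 0" if "Q \<in> quadratic_forms D" for Q
      using w that unfolding U_def QQ_def by blast
    moreover have "w \<in> upper_half_plane"
      using w Y by (auto simp: U_def open_half_strip_def upper_half_plane_def)
    ultimately show "w \<in> upper_half_plane - exceptional_set D"
      unfolding Diff_iff mem_exceptional_set by blast
  qed
  ultimately show "\<exists>T. open T \<and> z \<in> T \<and> T \<subseteq> upper_half_plane - exceptional_set D" by blast
qed

text \<open>A diagonal line meets each geodesic in finitely many points, so only countably many of its points
  are exceptional.\<close>

lemma dense_complement_exceptional_set:
  assumes D: "D > 0" and z: "z \<in> upper_half_plane"
  shows "z \<in> closure (upper_half_plane - exceptional_set D)"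
  unfolding closure_approachable
proof (intro allI impI)
  fix e :: real assume e: "e > 0"
  define l where "l s = z + of_real s * Complex 1 1" for s
  have "finite {s. form_value Q (l s) = 0}" if Q: "Q \<in> quadratic_forms D" for Q
  proof -
    obtain a b c where abc: "Q = (a, b, c)" by (cases Q)
    define p :: "real poly" where
      "p = [:form_value Q z, 2 * of_int a * (Re z + Im z) + of_int b, 2 * of_int a:]"
    have "p \<noteq> 0"
    proof
      assume "p = 0"
      then have "a = 0" "b = 0" by (auto simp: p_def)
      then show False using Q D abc by (simp add: quadratic_forms_def)
    qed
    moreover have "form_value Q (l s) = poly p s" for s
      unfolding p_def abc form_value_def cmod_power2 l_def by (simp add: power2_eq_square algebra_simps)
    ultimately show ?thesis using poly_roots_finite[of p] by simp
  qed
  then have "countable (\<Union>Q\<in>quadratic_forms D. {s. form_value Q (l s) = 0})"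
    using countable_finite by (intro countable_UN) auto
  moreover have "uncountable {0<..<e / 2}" using e by (simp add: uncountable_open_interval)
  ultimately have "\<not> {0<..<e / 2} \<subseteq> (\<Union>Q\<in>quadratic_forms D. {s. form_value Q (l s) = 0})"
    using countable_subset by metis
  then obtain s where s: "s \<in> {0<..<e / 2}" "\<And>Q. Q \<in> quadratic_forms D \<Longrightarrow> form_value Q (l s) \<noteq> 0"
    by blast
  have "l s \<in> upper_half_plane - exceptional_set D"
  proof -
    have "l s \<in> upper_half_plane" using s(1) z by (simp add: upper_half_plane_def l_def)
    then show ?thesis using s(2) unfolding Diff_iff mem_exceptional_set by blast
  qed
  moreover have "dist (l s) z < e"
  proof -
    have "dist (l s) z = s * cmod (Complex 1 1)" using s by (simp add: dist_norm l_def norm_mult)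
    also have "\<dots> \<le> s * 2" using s cmod_le[of "Complex 1 1"] by (intro mult_left_mono) auto
    also have "\<dots> < e" using s by simp
    finally show ?thesis .
  qed
  ultimately show "\<exists>y\<in>upper_half_plane - exceptional_set D. dist y z < e" by blast
qed

text \<open>The form composed with \<open>\<gamma>\<close> vanishes at \<open>\<tau>\<close>, and its discriminant is \<open>D (det \<gamma>)\<^sup>2 = D\<close>.\<close>

lemma SL2Z_act_exceptional_set:
  assumes g: "\<gamma> \<in> SL2Z" and \<tau>: "\<tau> \<in> upper_half_plane" and ex: "SL2Z_act \<gamma> \<tau> \<in> exceptional_set D"
  shows "\<tau> \<in> exceptional_set D"
proof -
  define \<alpha> \<beta> c d where "\<alpha> = \<gamma>$1$1" and "\<beta> = \<gamma>$1$2" and "c = \<gamma>$2$1" and "d = \<gamma>$2$2"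
  have det: "\<alpha> * d - \<beta> * c = 1" using g by (simp add: SL2Z_def det_2 \<alpha>_def \<beta>_def c_def d_def)
  obtain A B C where Q: "(A, B, C) \<in> quadratic_forms D" "form_value (A, B, C) (SL2Z_act \<gamma> \<tau>) = 0"
    using ex unfolding mem_exceptional_set by (metis prod_cases3)
  define Q' where "Q' = (A * \<alpha>\<^sup>2 + B * \<alpha> * c + C * c\<^sup>2,
    2 * A * \<alpha> * \<beta> + B * (\<alpha> * d + \<beta> * c) + 2 * C * c * d, A * \<beta>\<^sup>2 + B * \<beta> * d + C * d\<^sup>2)"
  have "(2 * A * \<alpha> * \<beta> + B * (\<alpha> * d + \<beta> * c) + 2 * C * c * d)\<^sup>2
      - 4 * (A * \<alpha>\<^sup>2 + B * \<alpha> * c + C * c\<^sup>2) * (A * \<beta>\<^sup>2 + B * \<beta> * d + C * d\<^sup>2)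
     = (B\<^sup>2 - 4 * A * C) * (\<alpha> * d - \<beta> * c)\<^sup>2"
    by (simp add: power2_eq_square algebra_simps)
  then have Q'D: "Q' \<in> quadratic_forms D" using Q(1) det by (simp add: Q'_def quadratic_forms_def)
  define N J where "N = of_int \<alpha> * \<tau> + of_int \<beta>" and "J = of_int c * \<tau> + of_int d"
  have J: "automorphy \<gamma> \<tau> = J" "SL2Z_act \<gamma> \<tau> = N / J"
    by (simp_all add: SL2Z_act_def automorphy_def N_def J_def \<alpha>_def \<beta>_def c_def d_def)
  have J0: "J \<noteq> 0" using automorphy_nonzero[OF g \<tau>] J by simp
  define r where "r = (cmod J)\<^sup>2"
  have r: "r \<noteq> 0" using J0 by (simp add: r_def)
  have re: "r * Re (N / J) = Re N * Re J + Im N * Im J"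
    using r by (simp add: Re_divide cmod_power2 r_def)
  have cm: "r * (cmod (N / J))\<^sup>2 = (cmod N)\<^sup>2"
    using r by (simp add: norm_divide power_divide r_def)
  have "r * form_value (A, B, C) (N / J)
      = of_int A * (r * (cmod (N / J))\<^sup>2) + of_int B * (r * Re (N / J)) + of_int C * r"
    by (simp add: form_value_def algebra_simps)
  also have "\<dots> = of_int A * (cmod N)\<^sup>2 + of_int B * (Re N * Re J + Im N * Im J) + of_int C * r"
    unfolding re cm ..
  also have "\<dots> = form_value Q' \<tau>"
    unfolding form_value_def Q'_def N_def J_def r_def cmod_power2 by (simp add: power2_eq_square algebra_simps)
  finally have "form_value Q' \<tau> = 0" using Q(2) J by simp
  then show ?thesis using Q'D \<tau> unfolding mem_exceptional_set by blast
qed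

lemma modular_partition_exceptional_set:
  assumes D: "D > 0"
  shows "modular_partition (exceptional_set D)"
proof
  show "open (upper_half_plane - exceptional_set D)" by (rule open_complement_exceptional_set[OF D])
  show "SL2Z_act \<gamma> \<tau> \<notin> exceptional_set D"
    if "\<gamma> \<in> SL2Z" "\<tau> \<in> upper_half_plane - exceptional_set D" for \<gamma> \<tau>
    using SL2Z_act_exceptional_set that by blast
  fix \<tau> assume \<tau>: "\<tau> \<in> upper_half_plane"
  define U where "U = open_half_strip (\<bar>Re \<tau>\<bar> + 1) (Im \<tau> / 2)"
  define K where "K = half_strip (\<bar>Re \<tau>\<bar> + 1) (Im \<tau> / 2)"
  define CC where "CC = {C \<in> components (upper_half_plane - exceptional_set D). C \<inter> K \<noteq> {}}"
  have U: "open U" "\<tau> \<in> U" "U \<subseteq> K"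
    unfolding U_def K_def using open_open_half_strip mem_open_half_strip_self[OF \<tau>] open_half_strip_subset by auto
  have fin: "finite CC" unfolding CC_def K_def
    using \<tau> by (intro finite_components_meeting_half_strip[OF D]) (simp add: upper_half_plane_def)
  have adj: "adjacent_components (exceptional_set D) \<tau> =
      {C \<in> components (upper_half_plane - exceptional_set D). \<tau> \<in> closure C}"
    by (simp add: adjacent_components_def closure_Un_frontier)
  have "C \<in> CC" if C: "C \<in> components (upper_half_plane - exceptional_set D)" "\<tau> \<in> closure C" for C
  proof -
    have "U \<inter> C \<noteq> {}" using open_Int_closure_eq_empty[OF U(1), of C] U(2) C(2) by auto
    then show ?thesis using C(1) U(3) by (auto simp: CC_def)
  qed
  then have "adjacent_components (exceptional_set D) \<tau> \<subseteq> CC" unfolding adj by blast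
  then show "finite (adjacent_components (exceptional_set D) \<tau>)" using fin finite_subset by blast
  have "U \<inter> closure (upper_half_plane - exceptional_set D) \<subseteq> closure (U \<inter> (upper_half_plane - exceptional_set D))"
    by (rule open_Int_closure_subset[OF U(1)])
  then have "\<tau> \<in> closure (U \<inter> (upper_half_plane - exceptional_set D))"
    using dense_complement_exceptional_set[OF D \<tau>] U(2) by blast
  moreover have "U \<inter> (upper_half_plane - exceptional_set D) \<subseteq> \<Union>CC"
  proof
    fix x assume x: "x \<in> U \<inter> (upper_half_plane - exceptional_set D)"
    then obtain C where "C \<in> components (upper_half_plane - exceptional_set D)" "x \<in> C"
      by (metis IntE UnionE Union_components)
    then show "x \<in> \<Union>CC" using x U(3) by (auto simp: CC_def)
  qed
  ultimately have "\<tau> \<in> closure (\<Union>CC)" by (metis closure_mono subsetD)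
  moreover have "closure (\<Union>CC) \<subseteq> (\<Union>C\<in>CC. closure C)"
  proof (rule closure_minimal)
    show "\<Union>CC \<subseteq> (\<Union>C\<in>CC. closure C)" using closure_subset by fastforce
    show "closed (\<Union>C\<in>CC. closure C)" using fin by (intro closed_UN) auto
  qed
  ultimately have "\<tau> \<in> (\<Union>C\<in>CC. closure C)" by blast
  then show "adjacent_components (exceptional_set D) \<tau> \<noteq> {}" unfolding adj CC_def by blast
qed

lemma finite_covering_exceptional_set:
  assumes D: "D > 0"
  shows "\<exists>R. modular_partition.covering (exceptional_set D) R \<and> finite R"
proof -
  interpret modular_partition "exceptional_set D" by (rule modular_partition_exceptional_set[OF D])
  define R where "R = {C \<in> components (upper_half_plane - exceptional_set D). C \<inter> half_strip 1 (1/2) \<noteq> {}}"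
  have "covering R"
    unfolding covering_def
  proof (intro conjI ballI)
    fix \<tau> assume \<tau>: "\<tau> \<in> upper_half_plane - exceptional_set D"
    then obtain w where w: "w \<in> SL2Z_orbit \<tau>" "w \<in> half_strip 1 (1/2)"
      using SL2Z_reduction_half_strip[of \<tau>] by (auto simp: half_strip_def)
    then have "w \<in> upper_half_plane - exceptional_set D"
      using \<tau> SL2Z_act_notin SL2Z_act_in_upper_half_plane by (metis DiffD1 DiffI SL2Z_orbitE)
    then obtain C where "C \<in> comps" "w \<in> C" using ex_comp by blast
    then show "\<exists>w\<in>\<Union>R. w \<in> SL2Z_orbit \<tau>" using w unfolding R_def by blast
  qed (auto simp: R_def)
  moreover have "finite R" unfolding R_def by (rule finite_components_meeting_half_strip[OF D]) simp
  ultimately show ?thesis by blast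
qed

section \<open>Components with distinct equivalent points\<close>

text \<open>If \<open>D\<close> is not a square, then \<open>b\<^sup>2 = D\<close> is impossible, so there are no vertical geodesics. The half circles
  have bounded height, and the component above all of them is invariant under \<open>\<tau> \<mapsto> \<tau> + 1\<close>.\<close>

lemma component_equivalent_points_of_nonsquare:
  assumes D: "D > 0" and nsq: "\<nexists>m::int. D = m\<^sup>2"
  shows "\<exists>C\<in>components (upper_half_plane - exceptional_set D). \<exists>z\<in>C. \<exists>w\<in>C. w \<in> SL2Z_orbit z \<and> w \<noteq> z"
proof -
  define W where "W = {z. Im z > of_int D}"
  have sub: "W \<subseteq> upper_half_plane - exceptional_set D"
  proof
    fix z assume z: "z \<in> W"
    then have zD: "Im z > of_int D" by (simp add: W_def)
    have D1: "(of_int D :: real) \<ge> 1" using D by simp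
    have "form_value Q z \<noteq> 0" if "Q \<in> quadratic_forms D" for Q
    proof
      assume v: "form_value Q z = 0"
      obtain a b c where abc: "Q = (a, b, c)" by (cases Q)
      have disc: "(2 * of_int a * Re z + of_int b)\<^sup>2 + 4 * (of_int a)\<^sup>2 * (Im z)\<^sup>2 = of_int D"
        using form_value_discriminant that v unfolding abc by blast
      have "a \<noteq> 0" using nsq that abc by (auto simp: quadratic_forms_def)
      then have "a\<^sup>2 \<ge> 1" using zero_less_power2[of a] by linarith
      then have "(of_int (a\<^sup>2) :: real) \<ge> 1" by (simp only: of_int_1_le_iff)
      then have "1 * (Im z)\<^sup>2 \<le> 4 * (of_int a)\<^sup>2 * (Im z)\<^sup>2" by (intro mult_right_mono) auto
      then have "(Im z)\<^sup>2 \<le> of_int D" using disc zero_le_power2[of "2 * of_int a * Re z + of_int b"] by linarith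
      moreover have "Im z * 1 < Im z * Im z" using zD D1 by (intro mult_strict_left_mono) linarith+
      ultimately show False using zD by (simp add: power2_eq_square)
    qed
    then show "z \<in> upper_half_plane - exceptional_set D"
      using zD D1 by (auto simp: mem_exceptional_set upper_half_plane_def)
  qed
  have conn: "connected W" unfolding W_def by (rule convex_connected[OF convex_halfspace_Im_gt])
  define z where "z = Complex 0 (of_int D + 1)"
  have z: "z \<in> W" "z + 1 \<in> W" by (simp_all add: z_def W_def)
  then have "upper_half_plane - exceptional_set D \<noteq> {}" using sub by blast
  then obtain C where C: "C \<in> components (upper_half_plane - exceptional_set D)" "W \<subseteq> C"
    using exists_component_superset[OF sub _ conn] by blast
  have "SL2Z_act (mat2 1 1 0 1) z \<in> SL2Z_orbit z" by (intro mem_SL2Z_orbit mat2_in_SL2Z) simp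
  then have "z + 1 \<in> SL2Z_orbit z" by (simp add: SL2Z_act_mat2)
  then show ?thesis using C z by (intro bexI[OF _ C(1)] bexI[of _ z] bexI[of _ "z + 1"]) auto
qed

text \<open>For odd \<open>D\<close> the elliptic point \<open>\<rho> = exp(\<pi>i/3)\<close> is not exceptional, since \<open>a + b/2 + c = 0\<close> would make
  \<open>b\<close>, and with it \<open>D\<close>, even. The component of \<open>\<rho>\<close> is invariant under \<open>\<tau> \<mapsto> (\<tau> - 1)/\<tau>\<close>, which
  fixes \<open>\<rho>\<close> but no other point of the upper half-plane.\<close>

lemma component_equivalent_points_of_odd:
  assumes D: "D > 0" and odd: "odd D"
  shows "\<exists>C\<in>components (upper_half_plane - exceptional_set D). \<exists>z\<in>C. \<exists>w\<in>C. w \<in> SL2Z_orbit z \<and> w \<noteq> z"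
proof -
  interpret modular_partition "exceptional_set D" by (rule modular_partition_exceptional_set[OF D])
  define \<rho> where "\<rho> = Complex (1 / 2) (sqrt 3 / 2)"
  have \<rho>1: "(cmod \<rho>)\<^sup>2 = 1" unfolding \<rho>_def cmod_power2 by (simp add: power_divide)
  have "form_value Q \<rho> \<noteq> 0" if "Q \<in> quadratic_forms D" for Q
  proof
    assume v: "form_value Q \<rho> = 0"
    obtain a b c where abc: "Q = (a, b, c)" by (cases Q)
    have "of_int (2 * a + b + 2 * c) = (0::real)"
      using v \<rho>1 by (simp add: abc form_value_def) (simp add: \<rho>_def)
    then have "2 * a + b + 2 * c = 0" by (simp only: of_int_eq_0_iff)
    then have "b = - 2 * (a + c)" by simp
    then have "even b" by simp
    moreover have "D = b\<^sup>2 - 4 * a * c" using that abc by (auto simp: quadratic_forms_def)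
    ultimately show False using odd by simp
  qed
  then have "\<rho> \<in> upper_half_plane - exceptional_set D"
    by (auto simp: mem_exceptional_set upper_half_plane_def \<rho>_def)
  then obtain C where C: "C \<in> comps" "\<rho> \<in> C" using ex_comp by blast
  define U where "U = mat2 1 (-1) 1 0"
  have U: "U \<in> SL2Z" by (simp add: U_def mat2_in_SL2Z)
  have fix_iff: "SL2Z_act U z = z \<longleftrightarrow> z\<^sup>2 - z + 1 = 0" if "z \<in> C" for z
  proof -
    have "z \<noteq> 0" using comp_in_H[OF C(1) that] by (auto simp: upper_half_plane_def)
    then show ?thesis by (auto simp: U_def SL2Z_act_mat2 field_simps power2_eq_square)
  qed
  have "\<rho>\<^sup>2 - \<rho> + 1 = 0"
    by (simp add: \<rho>_def complex_eq_iff power2_eq_square)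
  then have "SL2Z_act U \<rho> = \<rho>" using fix_iff C by simp
  then have UC: "SL2Z_act U ` C \<subseteq> C" using SL2Z_act_comp_subset[OF C C(1) _ U] C(2) by simp
  have "finite {z. poly [:1, -1, 1::complex:] z = 0}" by (rule poly_roots_finite) simp
  then obtain z where z: "z \<in> C" "z \<notin> {z. poly [:1, -1, 1::complex:] z = 0}"
    by (rule ex_point_notin[OF C(1)])
  have "SL2Z_act U z \<noteq> z" using z fix_iff[OF z(1)] by (simp add: power2_eq_square algebra_simps)
  moreover have "SL2Z_act U z \<in> C" using UC z by blast
  ultimately show ?thesis using mem_SL2Z_orbit[OF U, of z] C(1) z(1) by blast
qed

text \<open>For \<open>D = 4m\<^sup>2\<close> the boundary of the standard fundamental domain is exceptional, being contained
  in the zero sets of \<open>[0, 2m, \<plusminus>m]\<close> and \<open>[m, 0, -m]\<close>. Every component therefore lies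
  in the interior of a translate of that domain.\<close>

lemma component_inequivalent_points_of_even_square:
  assumes m: "D = 4 * m\<^sup>2" and D: "D > 0"
    and C: "C \<in> components (upper_half_plane - exceptional_set D)" "z \<in> C" "w \<in> C" "w \<in> SL2Z_orbit z"
  shows "w = z"
proof -
  interpret modular_partition "exceptional_set D" by (rule modular_partition_exceptional_set[OF D])
  have m0: "m \<noteq> 0" using m D by auto
  have zH: "z \<in> upper_half_plane" and wH: "w \<in> upper_half_plane" using comp_in_H[OF C(1)] C by auto
  obtain \<gamma> where g: "\<gamma> \<in> SL2Z" "\<bar>Re (SL2Z_act \<gamma> z)\<bar> \<le> 1 / 2" "cmod (SL2Z_act \<gamma> z) \<ge> 1"
    by (rule SL2Z_reduction[OF zH])
  define C' where "C' = SL2Z_act \<gamma> ` C"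
  have C': "C' \<in> comps" "SL2Z_act \<gamma> z \<in> C'" "SL2Z_act \<gamma> w \<in> C'"
    unfolding C'_def using SL2Z_act_comp[OF C(1) g(1)] C by auto
  have wall: "\<bar>Re x\<bar> \<noteq> 1 / 2 \<and> cmod x \<noteq> 1" if x: "x \<in> C'" for x
  proof -
    have xH: "x \<in> upper_half_plane" and nE: "x \<notin> exceptional_set D" using x comp_subset[OF C'(1)] by auto
    have nz: "form_value Q x \<noteq> 0" if "Q \<in> quadratic_forms D" for Q
      using nE xH that unfolding mem_exceptional_set by blast
    have "(0, 2 * m, m) \<in> quadratic_forms D" "(0, 2 * m, - m) \<in> quadratic_forms D" "(m, 0, - m) \<in> quadratic_forms D"
      by (simp_all add: quadratic_forms_def m power2_eq_square)
    from this[THEN nz] have "of_int m * (2 * Re x + 1) \<noteq> 0" "of_int m * (2 * Re x - 1) \<noteq> 0"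
      "of_int m * ((cmod x)\<^sup>2 - 1) \<noteq> 0"
      by (simp_all add: form_value_def algebra_simps)
    then show ?thesis by (auto simp: abs_if split: if_splits)
  qed
  define A B where "A = {x. \<bar>Re x\<bar> < 1 / 2 \<and> cmod x > 1}" and "B = {x. \<bar>Re x\<bar> > 1 / 2 \<or> cmod x < 1}"
  have "open A" "open B" unfolding A_def B_def
    by (intro open_Collect_conj open_Collect_disj open_Collect_less continuous_intros)+
  moreover have "A \<inter> B \<inter> C' = {}" by (auto simp: A_def B_def)
  moreover have "C' \<subseteq> A \<union> B"
  proof
    fix x assume "x \<in> C'"
    from wall[OF this] show "x \<in> A \<union> B" by (auto simp: A_def B_def)
  qed
  moreover have "A \<inter> C' \<noteq> {}" using C'(2) wall[OF C'(2)] g by (force simp: A_def)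
  ultimately have "B \<inter> C' = {}" using connectedD[OF in_components_connected[OF C'(1)]] by blast
  then have sub: "C' \<subseteq> A" using \<open>C' \<subseteq> A \<union> B\<close> by blast
  have "SL2Z_orbit (SL2Z_act \<gamma> z) = SL2Z_orbit z" "SL2Z_orbit (SL2Z_act \<gamma> w) = SL2Z_orbit w"
    "SL2Z_orbit w = SL2Z_orbit z"
    using SL2Z_orbit_eq mem_SL2Z_orbit[OF g(1)] zH wH C(4) by blast+
  then have "SL2Z_act \<gamma> w \<in> SL2Z_orbit (SL2Z_act \<gamma> z)" using SL2Z_orbit_refl by blast
  moreover have "Im (SL2Z_act \<gamma> z) > 0"
    using SL2Z_act_in_upper_half_plane[OF g(1) zH] by (simp add: upper_half_plane_def)
  ultimately have "SL2Z_act \<gamma> w = SL2Z_act \<gamma> z"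
    using C'(2,3) sub by (intro interior_fundamental_domain_unique) (auto simp: A_def)
  then show ?thesis using SL2Z_act_inj[OF g(1) wH zH] by simp
qed

lemma components_separate_iff_even_square:
  assumes D: "D > 0"
  shows "(\<forall>C\<in>components (upper_half_plane - exceptional_set D). \<forall>z\<in>C. \<forall>w\<in>C. w \<in> SL2Z_orbit z \<longrightarrow> w = z)
    \<longleftrightarrow> (\<exists>m::int. D = 4 * m\<^sup>2)"
proof
  assume sep: "\<forall>C\<in>components (upper_half_plane - exceptional_set D). \<forall>z\<in>C. \<forall>w\<in>C. w \<in> SL2Z_orbit z \<longrightarrow> w = z"
  have "even D" using component_equivalent_points_of_odd[OF D] sep by blast
  moreover obtain m where m: "D = m\<^sup>2" using component_equivalent_points_of_nonsquare[OF D] sep by blast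
  ultimately have "even m" by simp
  then obtain l where "m = 2 * l" by blast
  then show "\<exists>m::int. D = 4 * m\<^sup>2" using m by (intro exI[of _ l]) (simp add: power_mult_distrib)
next
  assume "\<exists>m::int. D = 4 * m\<^sup>2"
  then show "\<forall>C\<in>components (upper_half_plane - exceptional_set D). \<forall>z\<in>C. \<forall>w\<in>C. w \<in> SL2Z_orbit z \<longrightarrow> w = z"
    using component_inequivalent_points_of_even_square D by blast
qed

theorem theorem1p1:
  fixes D k :: int
  assumes "D > 0" and "k < 0" and "even k"
  shows "(\<forall>F. fundamental_domain F \<longrightarrow>
            edim (modular_local_polynomials k (exceptional_set D))
              \<le> enat (nat \<bar>k\<bar> + 1) * num_components_meeting D F) \<and>
         (edim (modular_local_polynomials k (exceptional_set D))
              = enat (nat \<bar>k\<bar> + 1) *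
                (INF F\<in>{F. fundamental_domain F}. num_components_meeting D F)
            \<longleftrightarrow> (\<exists>m::int. D = 4 * m\<^sup>2))"
proof -
  interpret modular_partition "exceptional_set D" by (rule modular_partition_exceptional_set[OF assms(1)])
  define n where "n = nat \<bar>k\<bar>"
  have k: "k = - int n" using assms(2) by (simp add: n_def)
  have n: "even n" "n \<ge> 1" using assms(2,3) by (auto simp: n_def even_nat_iff)
  have num: "num_components_meeting D F = ecard (comps_meeting F)" for F
    by (simp add: num_components_meeting_def comps_meeting_def)
  obtain R where "covering R" "finite R" using finite_covering_exceptional_set[OF assms(1)] by blast
  then have "edim (modular_local_polynomials k (exceptional_set D))
      = enat (n + 1) * (INF F\<in>{F. fundamental_domain F}. num_components_meeting D F)
      \<longleftrightarrow> (\<exists>m::int. D = 4 * m\<^sup>2)"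
    unfolding num k components_separate_iff_even_square[OF assms(1), symmetric] by (rule edim_eq_iff[OF n])
  then show ?thesis using edim_le_comps_meeting[of _ n] unfolding num k[symmetric] n_def[symmetric] by blast
qed

end
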